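(* Let $p,q$ be two real numbers such that $p \ge 1$ and $q > (p-1)/p$. Then $$\bigl( \mu^{\boxplus p} \bigr)^{\uplus q} = \bigl( \mu^{\uplus q'} \bigr)^{\boxplus p'}, \qquad \forall\, \mu \in \mathcal{M},$$ where the exponents $p'$ and $q'$ are defined by $$p' := \frac{pq}{1-p+pq}, \qquad q' := 1-p+pq$$ (note that $p' \ge 1$ and $q' > 0$, so the convolution powers on the right-hand side make sense).
   Context: $\mathcal{M}$ is the set of Borel probability measures on $\mathbb{R}$; $\mathbb{C}^+$ is the open upper half-plane. For $\mu \in \mathcal{M}$: $G_\mu(z) = \int_{\mathbb{R}} \frac{d\mu(s)}{z-s}$ is the Cauchy transform and $F_\mu(z) = 1/G_\mu(z)$ the reciprocal Cauchy transform; $F_\mu$ is an analytic self-map of $\mathbb{C}^+$. For every $\alpha>0$ there is $\beta>0$ such that $F_\mu$ has an analytic right inverse $F_\mu^{-1}$ on $\Gamma_{\alpha,\beta}=\{z\in\mathbb{C}^+ : |\Re z|<\alpha\,\Im z,\ \Im z>\beta\}$ with $F_\mu^{-1}(z)/z\to 1$ as $z\to\infty$ in $\Gamma_{\alpha,\beta}$; put $V_\mu(z) = F_\mu^{-1}(z)-z$ there. For $t\ge 1$, the free additive convolution power $\mu^{\boxplus t}\in\mathcal{M}$ is the unique probability measure with $V_{\mu^{\boxplus t}} = tV_\mu$ on a common truncated cone (it is known to exist). For $t>0$, the Boolean convolution power $\mu^{\uplus t}\in\mathcal{M}$ is the unique probability measure with $F_{\mu^{\uplus t}}(z) = tF_\mu(z)+(1-t)z$,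 $z\in\mathbb{C}^+$ (it always exists). *)

theory Defs
  imports "HOL-Probability.Probability" "HOL-Complex_Analysis.Complex_Analysis"
begin

text \<open>Borel probability measures on the real line are represented by the library locale
  \<^locale>\<open>real_distribution\<close>.\<close>

definition upper_half_plane :: "complex set" where
  "upper_half_plane = {z. Im z > 0}"

definition cauchy_transform :: "real measure \<Rightarrow> complex \<Rightarrow> complex" where
  "cauchy_transform \<mu> z = (LINT s|\<mu>. 1 / (z - complex_of_real s))"

definition recip_cauchy :: "real measure \<Rightarrow> complex \<Rightarrow> complex" where
  "recip_cauchy \<mu> z = 1 / cauchy_transform \<mu> z"

definition truncated_cone :: "real \<Rightarrow> real \<Rightarrow> complex set" where
  "truncated_cone \<alpha> \<beta> = {z \<in> upper_half_plane. \<bar>Re z\<bar> < \<alpha> * Im z \<and> Im z > \<beta>}"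

text \<open>The values of \<open>g\<close> are required to lie in the upper half-plane, because
  \<^const>\<open>recip_cauchy\<close> is a total function, whereas the map being inverted is
  the self-map of the upper half-plane. The filter expresses that \<open>z\<close> tends to infinity
  inside the cone.\<close>

definition is_recip_cauchy_inverse ::
    "real measure \<Rightarrow> real \<Rightarrow> real \<Rightarrow> (complex \<Rightarrow> complex) \<Rightarrow> bool" where
  "is_recip_cauchy_inverse \<mu> \<alpha> \<beta> g \<longleftrightarrow>
     g holomorphic_on truncated_cone \<alpha> \<beta> \<and>
     (\<forall>z\<in>truncated_cone \<alpha> \<beta>. g z \<in> upper_half_plane \<and> recip_cauchy \<mu> (g z) = z) \<and>
     ((\<lambda>z. g z / z) \<longlongrightarrow> 1) (inf at_infinity (principal (truncated_cone \<alpha> \<beta>)))"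

definition is_V_transform ::
    "real measure \<Rightarrow> real \<Rightarrow> real \<Rightarrow> (complex \<Rightarrow> complex) \<Rightarrow> bool" where
  "is_V_transform \<mu> \<alpha> \<beta> V \<longleftrightarrow>
     (\<exists>g. is_recip_cauchy_inverse \<mu> \<alpha> \<beta> g \<and> (\<forall>z\<in>truncated_cone \<alpha> \<beta>. V z = g z - z))"

text \<open>Each power is the unique probability measure with the stated property; it is
  meaningful for \<open>t \<ge> 1\<close> in the free case and for \<open>t > 0\<close> in the Boolean case.\<close>

definition free_power :: "real measure \<Rightarrow> real \<Rightarrow> real measure" where
  "free_power \<mu> t = (THE \<nu>. real_distribution \<nu> \<and>
     (\<exists>\<alpha>>0. \<exists>\<beta>>0. \<exists>V W. is_V_transform \<mu> \<alpha> \<beta> V \<and> is_V_transform \<nu> \<alpha> \<beta> W \<and>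
        (\<forall>z\<in>truncated_cone \<alpha> \<beta>. W z = of_real t * V z)))"

definition boolean_power :: "real measure \<Rightarrow> real \<Rightarrow> real measure" where
  "boolean_power \<mu> t = (THE \<nu>. real_distribution \<nu> \<and>
     (\<forall>z\<in>upper_half_plane.
        recip_cauchy \<nu> z = of_real t * recip_cauchy \<mu> z + (1 - of_real t) * z))"

end

theory Submission
  imports Defs
begin

text \<open>
  Write \<open>F\<close> for the reciprocal Cauchy transform of \<open>\<mu>\<close> and
  \<open>H\<^bsub>\<mu>,t\<^esub>(w) = t w + (1 - t) F(w)\<close>. The free power \<open>\<nu>\<close> of exponent \<open>t \<ge> 1\<close> is characterised by
  \<open>F\<^sub>\<nu>(H\<^bsub>\<mu>,t\<^esub>(w)) = F(w)\<close> whenever \<open>w\<close> and \<open>H\<^bsub>\<mu>,t\<^esub>(w)\<close> lie in the upper half-plane. If \<open>B\<close> is the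
  Boolean power of \<open>\<mu>\<close> of exponent \<open>q'\<close>, then \<open>p' q' = p q\<close> gives \<open>H\<^bsub>B,p'\<^esub> = H\<^bsub>\<mu>,p\<^esub>\<close>, and the theorem
  becomes an identity between linear combinations of \<open>F(w)\<close> and \<open>w\<close>.

  Since free and Boolean powers are defined by a definite description, their existence and
  uniqueness are needed as well. Uniqueness is Stieltjes inversion; existence needs that every holomorphic
  \<open>F\<close> with \<open>Im F(z) \<ge> Im z\<close> and \<open>F(iy)/(iy) \<rightarrow> 1\<close> is a reciprocal Cauchy transform
  (a Poisson integral followed by a weak limit), and that \<open>H\<^bsub>\<mu>,t\<^esub>\<close> has a right inverse
  on the whole upper half-plane (the half-plane Schwarz-Pick inequality makes it injective and
  proper on the preimage of the upper half-plane).
\<close>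

subsection \<open>Cauchy transforms\<close>

text \<open>Write \<open>Finv\<close> for the right inverse of F on a cone. The relation defining
  the free power is \<open>Finv_nu(z) = z + t (Finv(z) - z)\<close>. Putting z = F(w) turns its
  right side into t w + (1 - t) F(w), and applying F of the power removes every inverse. The
  resulting equation mentions neither a cone nor a choice of right inverse, so it combines directly
  with Boolean powers, which are given by values of F on the whole half-plane. The restriction to
  H(w) in the upper half-plane matters: \<open>recip_cauchy\<close> is total, and below the real
  axis its values are reflections that need not continue it analytically.

  Both uses of inverses go through one function, K = F - id, which maps the upper half-plane into
  its closure. The product form of Schwarz-Pick for K controls z + c K(z) for either sign of c: c =
  1 is F itself, inverted near infinity, and c = 1 - t is H, inverted globally.\<close>

lemma mem_upper_half_plane [simp]: "z \<in> upper_half_plane \<longleftrightarrow> Im z > 0"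
  by (simp add: upper_half_plane_def)

lemma upper_half_plane_eq: "upper_half_plane = {z. 0 < Im z}"
  by auto

lemma open_upper_half_plane [simp]: "open upper_half_plane"
  by (simp add: upper_half_plane_eq open_halfspace_Im_gt)

lemma connected_upper_half_plane [simp]: "connected upper_half_plane"
  by (simp add: upper_half_plane_eq convex_halfspace_Im_gt convex_connected)

lemma Im_le_norm_diff_of_real: "Im z \<le> norm (z - complex_of_real s)"
  using abs_Im_le_cmod[of "z - complex_of_real s"] by simp

lemma diff_of_real_nonzero: "Im z > 0 \<Longrightarrow> z - complex_of_real s \<noteq> 0"
  by auto

lemma norm_cauchy_kernel_le: "Im z > 0 \<Longrightarrow> norm (1 / (z - complex_of_real s)) \<le> 1 / Im z"
  using Im_le_norm_diff_of_real[of z s] by (simp add: norm_divide frac_le)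

context real_distribution
begin

lemma prob_UNIV [simp]: "prob UNIV = 1"
  using prob_space by simp

lemma integrable_cauchy_kernel:
  assumes "Im z > 0"
  shows "integrable M (\<lambda>s. 1 / (z - complex_of_real s))"
  by (rule integrable_const_bound[where B="1 / Im z"])
     (use norm_cauchy_kernel_le[OF assms] in auto)

lemma norm_cauchy_transform_le:
  assumes "Im z > 0"
  shows "norm (cauchy_transform M z) \<le> 1 / Im z"
proof -
  have "norm (cauchy_transform M z) \<le> (LINT s|M. norm (1 / (z - complex_of_real s)))"
    unfolding cauchy_transform_def by (rule integral_norm_bound)
  also have "\<dots> \<le> (LINT s|M. 1 / Im z)"
    by (rule integral_mono)
       (use assms integrable_cauchy_kernel[OF assms] norm_cauchy_kernel_le[OF assms] in auto)
  finally show ?thesis by simp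
qed

lemma integrable_norm_cauchy_kernel_sq:
  assumes "Im z > 0"
  shows "integrable M (\<lambda>s. (norm (1 / (z - complex_of_real s)))\<^sup>2)"
  by (rule integrable_const_bound[where B="(1 / Im z)\<^sup>2"])
     (use norm_cauchy_kernel_le[OF assms] in \<open>auto intro!: power_mono\<close>)

lemma Im_cauchy_kernel:
  assumes "Im z > 0"
  shows "Im (1 / (z - complex_of_real s)) = - Im z * (norm (1 / (z - complex_of_real s)))\<^sup>2"
  by (simp add: norm_divide Im_divide_numeral Im_divide cmod_power2 power_divide)

lemma Im_cauchy_transform:
  assumes "Im z > 0"
  shows "Im (cauchy_transform M z) = - Im z * (LINT s|M. (norm (1 / (z - complex_of_real s)))\<^sup>2)"
  unfolding cauchy_transform_def
  by (subst integral_Im[symmetric, OF integrable_cauchy_kernel[OF assms]])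
     (simp only: Im_cauchy_kernel[OF assms] integral_mult_right_zero)

text \<open>The variance of the modulus of the kernel is nonnegative, which is Cauchy-Schwarz
  against the constant 1; here the total mass 1 enters.\<close>

lemma norm_cauchy_transform_sq_le:
  assumes "Im z > 0"
  shows "(norm (cauchy_transform M z))\<^sup>2 \<le> (LINT s|M. (norm (1 / (z - complex_of_real s)))\<^sup>2)"
proof -
  let ?k = "\<lambda>s. 1 / (z - complex_of_real s)"
  define I where "I = (LINT s|M. norm (?k s))"
  have int: "integrable M (\<lambda>s. norm (?k s))" "integrable M (\<lambda>s. (norm (?k s))\<^sup>2)"
    using integrable_cauchy_kernel[OF assms] integrable_norm_cauchy_kernel_sq[OF assms] by auto
  have "0 \<le> (LINT s|M. (norm (?k s) - I)\<^sup>2)" by simp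
  also have "(LINT s|M. (norm (?k s) - I)\<^sup>2)
      = (LINT s|M. (norm (?k s))\<^sup>2 - 2 * I * norm (?k s) + I\<^sup>2)"
    by (rule Bochner_Integration.integral_cong) (auto simp: power2_diff)
  also have "\<dots> = (LINT s|M. (norm (?k s))\<^sup>2) - 2 * I * I + I\<^sup>2"
    using int by (simp add: I_def)
  finally have "I\<^sup>2 \<le> (LINT s|M. (norm (?k s))\<^sup>2)" by (simp add: power2_eq_square)
  moreover have "(norm (cauchy_transform M z))\<^sup>2 \<le> I\<^sup>2"
    unfolding cauchy_transform_def I_def by (intro power_mono integral_norm_bound) auto
  ultimately show ?thesis by linarith
qed

lemma Im_cauchy_transform_neg:
  assumes "Im z > 0"
  shows "Im (cauchy_transform M z) < 0"
proof -
  let ?J = "LINT s|M. (norm (1 / (z - complex_of_real s)))\<^sup>2"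
  have "?J \<noteq> 0"
  proof
    assume "?J = 0"
    then have "AE s in M. (norm (1 / (z - complex_of_real s)))\<^sup>2 = 0"
      by (subst (asm) integral_nonneg_eq_0_iff_AE[OF integrable_norm_cauchy_kernel_sq[OF assms]]) auto
    then have "AE s in M. False" 
      using diff_of_real_nonzero[OF assms] by auto
    then show False using AE_False by simp
  qed
  moreover have "?J \<ge> 0" by simp
  ultimately have "?J > 0" by linarith
  then show ?thesis using assms by (simp only: Im_cauchy_transform[OF assms]) simp
qed

text \<open>Since Im(1/G) = -Im G / |G|^2 and -Im G is Im z times the integral of the squared
  kernel, this is the preceding variance bound. It makes F - id a map into the closed upper
  half-plane, the property on which all later estimates rest.\<close>

lemma Im_recip_cauchy_ge:
  assumes "Im z > 0"
  shows "Im z \<le> Im (recip_cauchy M z)"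
proof -
  let ?G = "cauchy_transform M z"
  have G: "Im ?G < 0" by (rule Im_cauchy_transform_neg[OF assms])
  then have n: "norm ?G > 0" by auto
  have "Im (recip_cauchy M z) = - Im ?G / (norm ?G)\<^sup>2"
    by (simp add: recip_cauchy_def Im_divide cmod_power2)
  moreover have "Im z * (norm ?G)\<^sup>2 \<le> - Im ?G"
    using mult_left_mono[OF norm_cauchy_transform_sq_le[OF assms], of "Im z"] assms
    by (simp add: Im_cauchy_transform[OF assms])
  moreover have "(norm ?G)\<^sup>2 > 0" using n by simp
  ultimately show ?thesis by (simp only: pos_le_divide_eq)
qed

lemma holomorphic_cauchy_transform: "cauchy_transform M holomorphic_on upper_half_plane"
proof (subst holomorphic_on_open)
  show "\<forall>z\<in>upper_half_plane. \<exists>f'. (cauchy_transform M has_field_derivative f') (at z)"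
  proof
    fix z assume "z \<in> upper_half_plane"
    then have z: "Im z > 0" by simp
    define D where "D = (LINT s|M. - (1 / (z - complex_of_real s))\<^sup>2)"
    have intD: "integrable M (\<lambda>s. - (1 / (z - complex_of_real s))\<^sup>2)"
      by (rule integrable_const_bound[where B="(1 / Im z)\<^sup>2"])
         (use norm_cauchy_kernel_le[OF z] in \<open>auto intro!: power_mono simp: norm_power simp del: norm_divide\<close>)
    \<comment> \<open>The difference quotient of the kernel minus its derivative is exactly (w - z)
      times kernel(w) kernel(z)^2. Within distance Im z / 2 of z the height of w exceeds Im z / 2,
      so the kernels are at most 2 / Im z and 1 / Im z, uniformly in s.\<close>
    have bound: "norm ((cauchy_transform M w - cauchy_transform M z) / (w - z) - D)
        \<le> norm (w - z) * (2 / Im z ^ 3)" if w: "w \<in> ball z (Im z / 2) - {z}" for w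
    proof -
      have "\<bar>Im (w - z)\<bar> < Im z / 2"
        using w abs_Im_le_cmod[of "w - z"] by (auto simp: dist_norm norm_minus_commute)
      then have Iw: "Im w > Im z / 2" by (simp add: abs_if split: if_splits)
      then have Iw0: "Im w > 0" using z by simp
      have eq: "(1 / (w - complex_of_real s) - 1 / (z - complex_of_real s)) / (w - z) 
            - (- (1 / (z - complex_of_real s))\<^sup>2)
          = (w - z) * ((1 / (w - complex_of_real s)) * (1 / (z - complex_of_real s))\<^sup>2)" for s
      proof -
        define a where "a = w - complex_of_real s"
        define b where "b = z - complex_of_real s"
        have "w \<noteq> z" using w by auto
        then have ab: "a \<noteq> 0" "b \<noteq> 0" "a - b \<noteq> 0" and wz: "w - z = a - b"
          using diff_of_real_nonzero[OF z, of s] diff_of_real_nonzero[OF Iw0, of s]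
          by (auto simp: a_def b_def)
        have "1 / a - 1 / b = (a - b) * (- (1 / (a * b)))"
          using ab by (simp add: field_simps)
        then have "(1 / a - 1 / b) / (a - b) = - (1 / (a * b))"
          using ab by simp
        moreover have "- (1 / (a * b)) - (- (1 / b)\<^sup>2) = (a - b) * ((1 / a) * (1 / b)\<^sup>2)"
          using ab by (simp add: field_simps power2_eq_square)
        ultimately have "(1 / a - 1 / b) / (a - b) - (- (1 / b)\<^sup>2) = (a - b) * ((1 / a) * (1 / b)\<^sup>2)"
          by (simp only:)
        then show ?thesis unfolding wz a_def b_def .
      qed
      let ?kw = "\<lambda>s. 1 / (w - complex_of_real s)" and ?kz = "\<lambda>s. 1 / (z - complex_of_real s)"
      have int: "integrable M ?kw" "integrable M ?kz" "integrable M (\<lambda>s. (?kw s - ?kz s) / (w - z))"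
        using integrable_cauchy_kernel[OF z] integrable_cauchy_kernel[OF Iw0] by auto
      have "cauchy_transform M w - cauchy_transform M z = (LINT s|M. ?kw s - ?kz s)"
        unfolding cauchy_transform_def
        by (rule Bochner_Integration.integral_diff[OF int(1,2), symmetric])
      then have "(cauchy_transform M w - cauchy_transform M z) / (w - z) - D
          = (LINT s|M. (?kw s - ?kz s) / (w - z)) - D"
        by (simp only: integral_divide_zero)
      also have "\<dots> = (LINT s|M. (?kw s - ?kz s) / (w - z) - (- (?kz s)\<^sup>2))"
        unfolding D_def by (rule Bochner_Integration.integral_diff[OF int(3) intD, symmetric])
      also have "\<dots> = (LINT s|M. (w - z) * (?kw s * (?kz s)\<^sup>2))"
        by (rule Bochner_Integration.integral_cong[OF refl eq])
      finally have e: "(cauchy_transform M w - cauchy_transform M z) / (w - z) - D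
          = (LINT s|M. (w - z) * (?kw s * (?kz s)\<^sup>2))" .
      have k: "norm ((w - z) * ((1 / (w - complex_of_real s)) * (1 / (z - complex_of_real s))\<^sup>2))
          \<le> norm (w - z) * (2 / Im z ^ 3)" for s
      proof -
        have "norm (1 / (w - complex_of_real s)) \<le> 2 / Im z"
          using norm_cauchy_kernel_le[OF Iw0, of s] Iw z
          by (intro order.trans[OF norm_cauchy_kernel_le[OF Iw0]]) (simp add: field_simps)
        moreover have "norm ((1 / (z - complex_of_real s))\<^sup>2) \<le> (1 / Im z)\<^sup>2"
          using norm_cauchy_kernel_le[OF z, of s] unfolding norm_power by (intro power_mono) auto
        ultimately have "norm ((1 / (w - complex_of_real s)) * (1 / (z - complex_of_real s))\<^sup>2)
          \<le> (2 / Im z) * (1 / Im z)\<^sup>2"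
          unfolding norm_mult using z by (intro mult_mono) auto
        also have "\<dots> = 2 / Im z ^ 3" by (simp add: power2_eq_square power3_eq_cube)
        finally show ?thesis by (subst norm_mult) (rule mult_left_mono, auto)
      qed
      have "norm (LINT s|M. (w - z) * ((1 / (w - complex_of_real s)) * (1 / (z - complex_of_real s))\<^sup>2))
         \<le> (LINT s|M. norm (w - z) * (2 / Im z ^ 3))"
      proof (rule order.trans[OF integral_norm_bound integral_mono])
        show "integrable M (\<lambda>s. norm ((w - z) * ((1 / (w - complex_of_real s)) * (1 / (z - complex_of_real s))\<^sup>2)))"
          by (rule integrable_const_bound[where B="norm (w - z) * (2 / Im z ^ 3)"]) (use k in auto)
      qed (use k in auto)
      then show ?thesis unfolding e by simp
    qed
    have "((\<lambda>w. (cauchy_transform M w - cauchy_transform M z) / (w - z) - D) \<longlongrightarrow> 0) (at z)"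
    proof (rule Lim_null_comparison)
      show "\<forall>\<^sub>F w in at z. norm ((cauchy_transform M w - cauchy_transform M z) / (w - z) - D)
         \<le> norm (w - z) * (2 / Im z ^ 3)"
        unfolding eventually_at using z bound
        by (intro exI[of _ "Im z / 2"]) (auto simp: dist_commute)
      show "((\<lambda>w. norm (w - z) * (2 / Im z ^ 3)) \<longlongrightarrow> 0) (at z)"
        by (rule tendsto_eq_intros | simp)+
    qed
    then show "\<exists>f'. (cauchy_transform M has_field_derivative f') (at z)"
      unfolding has_field_derivative_iff by (auto simp: LIM_zero_iff intro!: exI[of _ D])
  qed
qed simp

lemma cauchy_transform_nonzero: "Im z > 0 \<Longrightarrow> cauchy_transform M z \<noteq> 0"
  using Im_cauchy_transform_neg by fastforce

lemma holomorphic_recip_cauchy: "recip_cauchy M holomorphic_on upper_half_plane"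
  unfolding recip_cauchy_def [abs_def]
  by (intro holomorphic_intros holomorphic_cauchy_transform) (simp add: cauchy_transform_nonzero)

text \<open>The quantity z G(z) - 1 is the integral of s / (z - s). On the cone above height n this
  integrand has a majorant that does not depend on z, and dominated convergence makes the integral
  of the majorant small. The error is measured in Im z, which is comparable with |z| on a
  cone.\<close>

lemma recip_cauchy_close_on_cone:
  assumes "\<alpha> > 0" "\<epsilon> > 0"
  shows "\<exists>\<beta>>0. \<forall>z\<in>truncated_cone \<alpha> \<beta>. norm (recip_cauchy M z - z) \<le> \<epsilon> * Im z"
proof -
  \<comment> \<open>The constant bound comes from |s| \<le> |z| + |z - s| and |z| \<le> (1 +
    \<alpha>) Im z \<le> (1 + \<alpha>) |z - s|, the decaying bound from |z - s| \<ge> Im z >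
    n.\<close>
  define \<psi> where "\<psi> n s = min (2 + \<alpha>) (\<bar>s\<bar> / real n)" for n s
  have "(\<lambda>n. LINT s|M. \<psi> n s) \<longlonglongrightarrow> (LINT s|M. 0)"
  proof (rule integral_dominated_convergence[where w="\<lambda>_. 2 + \<alpha>"])
    show "AE s in M. (\<lambda>n. \<psi> n s) \<longlonglongrightarrow> 0"
    proof (rule AE_I2)
      fix s :: real
      have "(\<lambda>n. min (2 + \<alpha>) (\<bar>s\<bar> / real n)) \<longlonglongrightarrow> min (2 + \<alpha>) 0"
        by (intro tendsto_min tendsto_const lim_const_over_n)
      then show "(\<lambda>n. \<psi> n s) \<longlonglongrightarrow> 0" using assms by (simp add: \<psi>_def)
    qed
  qed (use assms in \<open>auto simp: \<psi>_def\<close>)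
  then have lim: "(\<lambda>n. LINT s|M. \<psi> n s) \<longlonglongrightarrow> 0" by simp
  \<comment> \<open>The bound 1/2 keeps |z G(z)| above 1/2, and dividing by it costs the factor 2;
    the factor 1 + \<alpha> is lost in replacing |z| by Im z.\<close>
  define \<delta> where "\<delta> = min (1/2) (\<epsilon> / (2 * (1 + \<alpha>)))"
  have \<delta>: "\<delta> > 0" "\<delta> \<le> 1/2" "2 * (1 + \<alpha>) * \<delta> \<le> \<epsilon>"
  proof -
    have "\<delta> \<le> \<epsilon> / (2 * (1 + \<alpha>))" by (simp add: \<delta>_def)
    then show "2 * (1 + \<alpha>) * \<delta> \<le> \<epsilon>"
      using assms by (simp add: pos_le_divide_eq mult.commute)
  qed (use assms in \<open>auto simp: \<delta>_def min_def\<close>)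
  have "eventually (\<lambda>n. (LINT s|M. \<psi> n s) < \<delta> \<and> n > 0) sequentially"
    using order_tendstoD(2)[OF lim \<delta>(1)] eventually_gt_at_top[of 0] by eventually_elim auto
  then obtain n where n: "(LINT s|M. \<psi> n s) < \<delta>" "n > 0"
    by (auto simp: eventually_sequentially)
  show ?thesis
  proof (intro exI[of _ "real n"] conjI ballI)
    show "real n > 0" using n by simp
    fix z assume "z \<in> truncated_cone \<alpha> (real n)"
    then have z: "Im z > 0" "\<bar>Re z\<bar> < \<alpha> * Im z" "Im z > real n"
      by (auto simp: truncated_cone_def)
    have nz: "norm z \<le> (1 + \<alpha>) * Im z"
      using cmod_le[of z] z by (simp add: algebra_simps)
    have z0: "z \<noteq> 0" using z by auto
    let ?G = "cauchy_transform M z"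
    have int1: "integrable M (\<lambda>s. z * (1 / (z - complex_of_real s)) - 1)"
      by (intro Bochner_Integration.integrable_diff integrable_mult_right
          integrable_cauchy_kernel z(1) integrable_const)
    have "z * ?G - 1 = (LINT s|M. z * (1 / (z - complex_of_real s)) - 1)"
      unfolding cauchy_transform_def using integrable_cauchy_kernel[OF z(1)]
      by (subst Bochner_Integration.integral_diff[OF integrable_mult_right integrable_const])
         (simp_all only: integral_mult_right_zero lebesgue_integral_const prob_UNIV space_eq_univ scaleR_one)
    also have "norm \<dots> \<le> (LINT s|M. norm (z * (1 / (z - complex_of_real s)) - 1))"
      by (rule integral_norm_bound)
    also have "\<dots> \<le> (LINT s|M. \<psi> n s)"
    proof (rule integral_mono)
      show "integrable M (\<psi> n)"
        by (rule integrable_const_bound[where B="2 + \<alpha>"]) (use assms in \<open>auto simp: \<psi>_def [abs_def]\<close>)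
      fix s
      let ?d = "norm (z - complex_of_real s)"
      have d: "?d \<ge> Im z" by (rule Im_le_norm_diff_of_real)
      have "z * (1 / (z - complex_of_real s)) - 1 = complex_of_real s / (z - complex_of_real s)"
        using diff_of_real_nonzero[OF z(1), of s] by (simp add: field_simps)
      then have e: "norm (z * (1 / (z - complex_of_real s)) - 1) = \<bar>s\<bar> / ?d"
        by (simp add: norm_divide)
      have "\<bar>s\<bar> \<le> norm z + ?d"
        using norm_triangle_ineq4[of z "z - complex_of_real s"] by simp
      also have "\<dots> \<le> (1 + \<alpha>) * ?d + ?d"
        using nz mult_left_mono[OF d, of "1 + \<alpha>"] assms by linarith
      finally have "\<bar>s\<bar> \<le> (2 + \<alpha>) * ?d" by (simp add: algebra_simps)
      moreover have d0: "?d > 0" using d z(1) by linarith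
      ultimately have "\<bar>s\<bar> / ?d \<le> 2 + \<alpha>" by (simp only: pos_divide_le_eq)
      moreover have "\<bar>s\<bar> / ?d \<le> \<bar>s\<bar> / real n"
        using d d0 z n by (intro divide_left_mono mult_pos_pos) auto
      ultimately show "norm (z * (1 / (z - complex_of_real s)) - 1) \<le> \<psi> n s"
        unfolding e \<psi>_def by simp
    qed (use int1 in auto)
    finally have zG: "norm (z * ?G - 1) < \<delta>" using n by linarith
    then have zG2: "norm (z * ?G) \<ge> 1/2"
      using norm_triangle_ineq4[of "z * ?G" "z * ?G - 1"] \<delta>(2) by simp
    have "recip_cauchy M z - z = z * (1 - z * ?G) / (z * ?G)"
      using z0 cauchy_transform_nonzero[OF z(1)] by (simp add: recip_cauchy_def field_simps)
    then have "norm (recip_cauchy M z - z) = norm z * norm (z * ?G - 1) / norm (z * ?G)"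
      by (simp only: norm_mult norm_divide norm_minus_commute)
    also have "\<dots> \<le> ((1 + \<alpha>) * Im z) * \<delta> / (1/2)"
      using zG zG2 nz z assms \<delta> by (intro frac_le mult_mono) auto
    also have "\<dots> = 2 * (1 + \<alpha>) * \<delta> * Im z" by simp
    also have "\<dots> \<le> \<epsilon> * Im z" using \<delta> z by (intro mult_right_mono) auto
    finally show "norm (recip_cauchy M z - z) \<le> \<epsilon> * Im z" .
  qed
qed

end

subsection \<open>Stieltjes inversion\<close>

text \<open>The mean value theorem applies because the derivative 1 / (1 + x^2) is Lipschitz with
  constant 1. The error does not depend on u, so after scaling it survives integration over s and
  permits differentiation under the integral.\<close>

lemma arctan_linear_approx:
  fixes u h :: real
  shows "\<bar>arctan (u + h) - arctan u - h / (1 + u\<^sup>2)\<bar> \<le> h\<^sup>2"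
proof -
  have lip: "\<bar>1 / (1 + \<xi>\<^sup>2) - 1 / (1 + u\<^sup>2)\<bar> \<le> \<bar>\<xi> - u\<bar>" for \<xi> :: real
  proof -
    have pos: "1 + \<xi>\<^sup>2 > 0" "1 + u\<^sup>2 > 0" by (auto intro: add_pos_nonneg)
    have "\<bar>\<xi>\<bar> + \<bar>u\<bar> \<le> (1 + \<xi>\<^sup>2) * (1 + u\<^sup>2)"
    proof -
      have "2 * \<bar>\<xi>\<bar> \<le> 1 + \<xi>\<^sup>2" "2 * \<bar>u\<bar> \<le> 1 + u\<^sup>2"
        using zero_le_power2[of "\<bar>\<xi>\<bar> - 1"] zero_le_power2[of "\<bar>u\<bar> - 1"]
        by (auto simp: power2_diff)
      moreover have "(1 + \<xi>\<^sup>2) * (1 + u\<^sup>2) \<ge> 1 + \<xi>\<^sup>2 + u\<^sup>2"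
        by (simp add: algebra_simps)
      moreover have "\<xi>\<^sup>2 \<ge> 0" "u\<^sup>2 \<ge> 0" by simp_all
      ultimately show ?thesis by linarith
    qed
    moreover have "\<bar>u + \<xi>\<bar> \<le> \<bar>\<xi>\<bar> + \<bar>u\<bar>" by linarith
    ultimately have "\<bar>u + \<xi>\<bar> / ((1 + \<xi>\<^sup>2) * (1 + u\<^sup>2)) \<le> 1"
      using pos by (subst pos_divide_le_eq) auto
    moreover have "1 / (1 + \<xi>\<^sup>2) - 1 / (1 + u\<^sup>2) = (u - \<xi>) * ((u + \<xi>) / ((1 + \<xi>\<^sup>2) * (1 + u\<^sup>2)))"
      using pos by (simp add: diff_frac_eq power2_eq_square algebra_simps)
    then have "\<bar>1 / (1 + \<xi>\<^sup>2) - 1 / (1 + u\<^sup>2)\<bar> = \<bar>\<xi> - u\<bar> * (\<bar>u + \<xi>\<bar> / ((1 + \<xi>\<^sup>2) * (1 + u\<^sup>2)))"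
      using pos by (simp add: abs_mult abs_minus_commute)
    ultimately show ?thesis
      using mult_left_mono[of "\<bar>u + \<xi>\<bar> / ((1 + \<xi>\<^sup>2) * (1 + u\<^sup>2))" 1 "\<bar>\<xi> - u\<bar>"] by simp
  qed
  have mvt: "\<exists>\<xi>. \<bar>\<xi> - u\<bar> \<le> \<bar>h\<bar> \<and> arctan (u + h) - arctan u = h / (1 + \<xi>\<^sup>2)"
  proof -
    have D: "(arctan has_real_derivative 1 / (1 + x\<^sup>2)) (at x)" for x :: real
      using DERIV_arctan[of x] by (simp add: divide_inverse)
    consider "h > 0" | "h = 0" | "h < 0" by linarith
    then show ?thesis
    proof cases
      case 1
      then obtain z where "z > u" "z < u + h" "arctan (u + h) - arctan u = (u + h - u) * (1 / (1 + z\<^sup>2))"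
        using MVT2[of u "u + h" arctan "\<lambda>x. 1 / (1 + x\<^sup>2)"] D by auto
      then show ?thesis by (intro exI[of _ z]) auto
    next
      case 3
      then obtain z where "z > u + h" "z < u" "arctan u - arctan (u + h) = (u - (u + h)) * (1 / (1 + z\<^sup>2))"
        using MVT2[of "u + h" u arctan "\<lambda>x. 1 / (1 + x\<^sup>2)"] D by auto
      then show ?thesis by (intro exI[of _ z]) auto
    qed (auto intro!: exI[of _ u])
  qed
  then obtain \<xi> where \<xi>: "\<bar>\<xi> - u\<bar> \<le> \<bar>h\<bar>" "arctan (u + h) - arctan u = h / (1 + \<xi>\<^sup>2)"
    by blast
  have "\<bar>h / (1 + \<xi>\<^sup>2) - h / (1 + u\<^sup>2)\<bar> = \<bar>h\<bar> * \<bar>1 / (1 + \<xi>\<^sup>2) - 1 / (1 + u\<^sup>2)\<bar>"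
    by (simp add: abs_mult [symmetric] right_diff_distrib)
  also have "\<dots> \<le> \<bar>h\<bar> * \<bar>h\<bar>"
    using lip[of \<xi>] \<xi>(1) by (intro mult_left_mono) auto
  finally show ?thesis unfolding \<xi>(2) by (simp add: power2_eq_square abs_mult_self_eq)
qed

lemma difference_quotient_bound:
  fixes h :: real
  assumes "h \<noteq> 0" "\<bar>a - h * p\<bar> \<le> h\<^sup>2 / k"
  shows "\<bar>a / h - p\<bar> \<le> \<bar>h\<bar> / k"
proof -
  have "a / h - p = (a - h * p) / h"
    using assms(1) by (simp add: diff_divide_distrib)
  then have "\<bar>a / h - p\<bar> = \<bar>a - h * p\<bar> / \<bar>h\<bar>"
    by (simp only: abs_divide)
  also have "\<dots> \<le> \<bar>h\<bar> / k"
  proof (subst pos_divide_le_eq)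
    show "\<bar>a - h * p\<bar> \<le> \<bar>h\<bar> / k * \<bar>h\<bar>"
      using assms(2) by (simp add: power2_eq_square)
  qed (use assms(1) in simp)
  finally show ?thesis .
qed

context real_distribution
begin

lemma AE_norm_arctan_le: "AE s in M. norm (arctan (f s)) \<le> pi / 2"
proof (rule AE_I2)
  show "norm (arctan (f s)) \<le> pi / 2" for s
    using arctan_bounded[of "f s"] by (simp only: real_norm_def) linarith
qed

lemma integrable_arctan: "integrable M (\<lambda>s. arctan (a * (b - s)))"
  by (rule integrable_const_bound[where B="pi / 2"], rule AE_norm_arctan_le) simp

lemma Im_cauchy_transform_Complex:
  assumes "y > 0"
  shows "- Im (cauchy_transform M (Complex x y)) = (LINT s|M. (1 / y) / (1 + ((1 / y) * (x - s))\<^sup>2))"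
proof -
  have "y * (norm (1 / (Complex x y - complex_of_real s)))\<^sup>2 = (1 / y) / (1 + ((1 / y) * (x - s))\<^sup>2)" for s
  proof -
    have "y\<^sup>2 + (x - s)\<^sup>2 > 0" using assms by (intro add_pos_nonneg) auto
    moreover have "(norm (Complex x y - complex_of_real s))\<^sup>2 = y\<^sup>2 + (x - s)\<^sup>2"
      by (simp add: cmod_power2)
    moreover have "1 + ((1 / y) * (x - s))\<^sup>2 = (y\<^sup>2 + (x - s)\<^sup>2) / y\<^sup>2"
      using assms by (simp add: power_mult_distrib power_divide field_simps)
    ultimately show ?thesis using assms
      by (simp add: norm_divide power_divide power2_eq_square)
  qed
  then show ?thesis
    using assms by (subst Im_cauchy_transform) (simp_all flip: integral_mult_right_zero)
qed

text \<open>
  The arctangent is a primitive of the Poisson kernel, so integrated arctangents are determined by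
  the Cauchy transform without any use of Fubini.
\<close>

lemma DERIV_integral_arctan:
  assumes "y > 0"
  shows "((\<lambda>x. LINT s|M. arctan ((1 / y) * (x - s))) has_real_derivative
           - Im (cauchy_transform M (Complex x y))) (at x)"
proof -
  let ?A = "\<lambda>x. LINT s|M. arctan ((1 / y) * (x - s))"
  let ?P = "\<lambda>s. (1 / y) / (1 + ((1 / y) * (x - s))\<^sup>2)"
  have pos: "1 + ((1 / y) * (x - s))\<^sup>2 \<ge> 1" for s by simp
  have intP: "integrable M ?P"
  proof (rule integrable_const_bound[where B="1 / y"])
    show "?P \<in> borel_measurable M" by simp
    show "AE s in M. norm (?P s) \<le> 1 / y"
    proof (rule AE_I2)
      fix s
      have "1 + ((1 / y) * (x - s))\<^sup>2 > 0" using pos[of s] by linarith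
      then have "(1 / y) / (1 + ((1 / y) * (x - s))\<^sup>2) \<le> (1 / y) / 1"
        using assms pos[of s] by (intro divide_left_mono) auto
      then show "norm (?P s) \<le> 1 / y" using assms pos[of s] by simp
    qed
  qed
  have bound: "\<bar>(?A (x + h) - ?A x) / h - (LINT s|M. ?P s)\<bar> \<le> \<bar>h\<bar> / y\<^sup>2" if "h \<noteq> 0" for h
  proof -
    have "\<bar>?A (x + h) - ?A x - h * (LINT s|M. ?P s)\<bar> =
        \<bar>LINT s|M. arctan ((1 / y) * (x + h - s)) - arctan ((1 / y) * (x - s)) - h * ?P s\<bar>"
      by (subst Bochner_Integration.integral_diff[OF Bochner_Integration.integrable_diff
            [OF integrable_arctan integrable_arctan] integrable_mult_right[OF intP]],
          subst Bochner_Integration.integral_diff[OF integrable_arctan integrable_arctan])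
         (simp only: integral_mult_right_zero)
    also have "\<dots> \<le> (LINT s|M. \<bar>arctan ((1 / y) * (x + h - s)) - arctan ((1 / y) * (x - s)) - h * ?P s\<bar>)"
      by (rule integral_abs_bound)
    also have "\<dots> \<le> (LINT s|M. h\<^sup>2 / y\<^sup>2)"
    proof (rule integral_mono)
      show "integrable M (\<lambda>s. \<bar>arctan ((1 / y) * (x + h - s)) - arctan ((1 / y) * (x - s)) - h * ?P s\<bar>)"
        by (intro integrable_abs Bochner_Integration.integrable_diff integrable_arctan integrable_mult_right intP)
      fix s
      show "\<bar>arctan ((1 / y) * (x + h - s)) - arctan ((1 / y) * (x - s)) - h * ?P s\<bar> \<le> h\<^sup>2 / y\<^sup>2"
      proof -
        have "(1 / y) * (x + h - s) = (1 / y) * (x - s) + h / y"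
          by (simp add: add_divide_distrib diff_divide_distrib)
        moreover have "h * ?P s = (h / y) / (1 + ((1 / y) * (x - s))\<^sup>2)" by simp
        ultimately show ?thesis
          using arctan_linear_approx[of "(1 / y) * (x - s)" "h / y"]
          unfolding power_divide by (simp only:)
      qed
    qed simp
    finally have "\<bar>?A (x + h) - ?A x - h * (LINT s|M. ?P s)\<bar> \<le> h\<^sup>2 / y\<^sup>2"
      by (simp only: lebesgue_integral_const prob_UNIV space_eq_univ scaleR_one)
    then show ?thesis by (rule difference_quotient_bound[OF that])
  qed
  have "((\<lambda>h. (?A (x + h) - ?A x) / h - (LINT s|M. ?P s)) \<longlongrightarrow> 0) (at 0)"
  proof (rule Lim_null_comparison)
    show "\<forall>\<^sub>F h in at 0. norm ((?A (x + h) - ?A x) / h - (LINT s|M. ?P s)) \<le> \<bar>h\<bar> / y\<^sup>2"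
      unfolding eventually_at real_norm_def
    proof (intro exI[of _ 1] conjI ballI impI)
      show "\<bar>(?A (x + h) - ?A x) / h - (LINT s|M. ?P s)\<bar> \<le> \<bar>h\<bar> / y\<^sup>2" if "h \<noteq> 0 \<and> dist h 0 < 1" for h
        by (rule bound) (use that in blast)
    qed simp
    show "((\<lambda>h. \<bar>h\<bar> / y\<^sup>2) \<longlongrightarrow> 0) (at 0)"
      using assms by (auto intro!: tendsto_eq_intros)
  qed
  then have "((\<lambda>h. (?A (x + h) - ?A x) / h) \<longlongrightarrow> (LINT s|M. ?P s)) (at 0)"
    by (simp only: LIM_zero_iff)
  then show ?thesis
    unfolding Im_cauchy_transform_Complex[OF assms] DERIV_def .
qed

text \<open>Fixes the constant of integration: the Cauchy transform gives only the derivative in x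
  of the integrated arctangent.\<close>

lemma integral_arctan_at_bot:
  assumes "y > 0"
  shows "(\<lambda>n. LINT s|M. arctan ((1 / y) * (- real n - s))) \<longlonglongrightarrow> - (pi / 2)"
proof -
  have "(\<lambda>n. LINT s|M. arctan ((1 / y) * (- real n - s))) \<longlonglongrightarrow> (LINT s|M. - (pi / 2))"
  proof (rule integral_dominated_convergence[where w="\<lambda>_. pi / 2"])
    show "AE s in M. (\<lambda>n. arctan ((1 / y) * (- real n - s))) \<longlonglongrightarrow> - (pi / 2)"
    proof (rule AE_I2, rule filterlim_compose[OF tendsto_arctan_at_bot])
      fix s
      show "filterlim (\<lambda>n. (1 / y) * (- real n - s)) at_bot sequentially"
        using assms by real_asymp
    qed
  qed (rule AE_norm_arctan_le | simp)+
  then show ?thesis by simp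
qed

text \<open>
  Evaluating at \<open>x + 1/n\<close> with scale \<open>1/n\<^sup>2\<close> makes the limit the right-continuous
  distribution function at every \<open>x\<close>, atoms included.
\<close>

lemma integral_arctan_tendsto_cdf:
  "(\<lambda>n. LINT s|M. arctan ((real (Suc n))\<^sup>2 * (x + 1 / real (Suc n) - s))) \<longlonglongrightarrow> pi * cdf M x - pi / 2"
proof -
  have "(\<lambda>n. LINT s|M. arctan ((real (Suc n))\<^sup>2 * (x + 1 / real (Suc n) - s)))
     \<longlonglongrightarrow> (LINT s|M. pi * indicator {..x} s - pi / 2)"
  proof (rule integral_dominated_convergence[where w="\<lambda>_. pi / 2"])
    show "AE s in M. (\<lambda>n. arctan ((real (Suc n))\<^sup>2 * (x + 1 / real (Suc n) - s)))
       \<longlonglongrightarrow> pi * indicator {..x} s - pi / 2"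
    proof (rule AE_I2)
      fix s
      show "(\<lambda>n. arctan ((real (Suc n))\<^sup>2 * (x + 1 / real (Suc n) - s)))
       \<longlonglongrightarrow> pi * indicator {..x} s - pi / 2"
      proof (cases "s \<le> x")
        case True
        \<comment> \<open>For s \<le> x the shift alone contributes (n+1)^2 / (n+1) = n + 1, even at
          an atom s = x. For s > x the term -(n+1)^2 (s - x) beats this linear contribution.\<close>
        have "filterlim (\<lambda>n. (real (Suc n))\<^sup>2 * (x + 1 / real (Suc n) - s)) at_top sequentially"
        proof (rule filterlim_at_top_mono[OF filterlim_real_sequentially], rule always_eventually, rule allI)
          fix n
          have "(real (Suc n))\<^sup>2 * (x - s) \<ge> 0" using True by simp
          then show "real n \<le> (real (Suc n))\<^sup>2 * (x + 1 / real (Suc n) - s)"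
            by (simp add: distrib_left right_diff_distrib power2_eq_square add_divide_distrib)
        qed
        from filterlim_compose[OF tendsto_arctan_at_top this] show ?thesis using True by simp
      next
        case False
        then have "s - x > 0" by simp
        then have "filterlim (\<lambda>n. (real (Suc n))\<^sup>2 * (1 / real (Suc n) - (s - x))) at_bot sequentially"
          by real_asymp
        then have "filterlim (\<lambda>n. (real (Suc n))\<^sup>2 * (x + 1 / real (Suc n) - s)) at_bot sequentially"
          by (simp add: algebra_simps)
        from filterlim_compose[OF tendsto_arctan_at_bot this] show ?thesis using False by simp
      qed
    qed
  qed (rule AE_norm_arctan_le | simp)+
  also have "(LINT s|M. pi * indicator {..x} s - pi / 2) = pi * cdf M x - pi / 2"
    by (subst Bochner_Integration.integral_diff) (simp_all add: cdf_def less_top[symmetric])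
  finally show ?thesis .
qed

end

theorem cauchy_transform_unique:
  assumes M: "real_distribution M" and N: "real_distribution N"
    and eq: "\<And>z. Im z > 0 \<Longrightarrow> cauchy_transform M z = cauchy_transform N z"
  shows "M = N"
proof -
  interpret M: real_distribution M by fact
  interpret N: real_distribution N by fact
  have A: "(LINT s|M. arctan ((1 / y) * (x - s))) = (LINT s|N. arctan ((1 / y) * (x - s)))"
    if y: "y > 0" for x y
  proof -
    define d where "d x = (LINT s|M. arctan ((1 / y) * (x - s))) - (LINT s|N. arctan ((1 / y) * (x - s)))" for x
    have "(d has_real_derivative 0) (at u)" for u
      unfolding d_def [abs_def]
      using DERIV_diff[OF M.DERIV_integral_arctan[OF y, of u] N.DERIV_integral_arctan[OF y, of u]]
        eq[of "Complex u y"] y by simp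
    then have const: "d u = d x" for u
      using DERIV_isconst_all by blast
    have "(\<lambda>n. d (- real n)) \<longlonglongrightarrow> - (pi / 2) - (- (pi / 2))"
      unfolding d_def by (intro tendsto_diff M.integral_arctan_at_bot N.integral_arctan_at_bot y)
    moreover have "(\<lambda>n. d (- real n)) = (\<lambda>n. d x)" by (rule ext, rule const)
    ultimately have "(\<lambda>n. d x) \<longlonglongrightarrow> 0" by simp
    then have "d x = 0" by (simp add: LIMSEQ_const_iff)
    then show ?thesis by (simp add: d_def)
  qed
  have "cdf M x = cdf N x" for x
  proof -
    have "(LINT s|M. arctan ((real (Suc n))\<^sup>2 * (x + 1 / real (Suc n) - s)))
       = (LINT s|N. arctan ((real (Suc n))\<^sup>2 * (x + 1 / real (Suc n) - s)))" for n
      using A[of "1 / (real (Suc n))\<^sup>2" "x + 1 / real (Suc n)"] by simp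
    then have "pi * cdf M x - pi / 2 = pi * cdf N x - pi / 2"
      using LIMSEQ_unique[OF M.integral_arctan_tendsto_cdf[of x]] N.integral_arctan_tendsto_cdf[of x]
      by simp
    then show ?thesis by simp
  qed
  then show ?thesis
    using cdf_unique[OF M N] by auto
qed

corollary recip_cauchy_unique:
  assumes "real_distribution M" "real_distribution N"
    and eq: "\<And>z. Im z > 0 \<Longrightarrow> recip_cauchy M z = recip_cauchy N z"
  shows "M = N"
  using assms(1,2) by (rule cauchy_transform_unique) (use eq in \<open>simp add: recip_cauchy_def\<close>)

subsection \<open>The Schwarz-Pick inequality in the upper half-plane\<close>

text \<open>Numerator and denominator of the pseudo-hyperbolic distance |z - a| / |z - cnj a| differ
  by an explicit product of heights. This allows Schwarz-Pick to be stated without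
  fractions.\<close>

lemma norm_diff_cnj_sq: "(norm (z - cnj a))\<^sup>2 = (norm (z - a))\<^sup>2 + 4 * (Im z * Im a)"
  unfolding cmod_power2 by (simp add: power2_eq_square algebra_simps)

text \<open>The map \<psi> is the inverse Cayley transform sending 0 to a. Positivity of the
  imaginary part is positivity of the Poisson kernel of the disc, (1 - |\<zeta>|^2) / |1 -
  \<zeta>|^2, the real part of (1 + \<zeta>) / (1 - \<zeta>).\<close>

lemma cayley_bij_half_plane:
  assumes "Im a > 0"
  defines "\<psi> \<equiv> \<lambda>\<zeta>. of_real (Re a) + \<i> * of_real (Im a) * ((1 + \<zeta>) / (1 - \<zeta>))"
  shows "norm \<zeta> < 1 \<Longrightarrow> Im (\<psi> \<zeta>) > 0"
    and "Im z > 0 \<Longrightarrow> norm ((z - a) / (z - cnj a)) < 1"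
    and "Im z > 0 \<Longrightarrow> \<psi> ((z - a) / (z - cnj a)) = z"
proof -
  assume n: "norm \<zeta> < 1"
  then have "(norm \<zeta>)\<^sup>2 < 1" by (simp add: power_less_one_iff abs_square_less_1)
  moreover have "\<zeta> \<noteq> 1" using n by auto
  then have "(norm (1 - \<zeta>))\<^sup>2 > 0" by simp
  moreover have "Re ((1 + \<zeta>) / (1 - \<zeta>)) = (1 - (norm \<zeta>)\<^sup>2) / (norm (1 - \<zeta>))\<^sup>2"
    unfolding cmod_power2 by (simp add: Re_divide power2_eq_square algebra_simps)
  ultimately have "Re ((1 + \<zeta>) / (1 - \<zeta>)) > 0" by simp
  moreover have "Im (of_real r + \<i> * of_real b * X) = b * Re X" for r b X
    by simp
  ultimately show "Im (\<psi> \<zeta>) > 0"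
    using assms by (simp only: \<psi>_def zero_less_mult_iff) simp
next
  assume z: "Im z > 0"
  have "Im z * Im a > 0" using z assms by simp
  then have "(norm (z - a))\<^sup>2 < (norm (z - cnj a))\<^sup>2"
    unfolding norm_diff_cnj_sq by linarith
  then have *: "norm (z - a) < norm (z - cnj a)"
    by (rule power_less_imp_less_base) simp
  then have "norm (z - cnj a) > 0"
    using norm_ge_zero[of "z - a"] by linarith
  with * show "norm ((z - a) / (z - cnj a)) < 1"
    by (simp add: norm_divide)
  have nz: "z - cnj a \<noteq> 0" using \<open>norm (z - cnj a) > 0\<close> by auto
  have na: "a - cnj a \<noteq> 0" using assms by (simp add: complex_eq_iff)
  have "1 - (z - a) / (z - cnj a) = (a - cnj a) / (z - cnj a)"
    "1 + (z - a) / (z - cnj a) = (2 * z - (a + cnj a)) / (z - cnj a)"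
    using nz by (simp_all add: field_simps)
  then have "(1 + (z - a) / (z - cnj a)) / (1 - (z - a) / (z - cnj a)) = (2 * z - (a + cnj a)) / (a - cnj a)"
    using nz by simp
  also have "\<dots> = (2 * (z - of_real (Re a))) / (2 * (\<i> * of_real (Im a)))"
    by (rule arg_cong2[where f="(/)"]) (auto simp: complex_eq_iff)
  also have "\<dots> = (z - of_real (Re a)) / (\<i> * of_real (Im a))"
    by (rule mult_divide_mult_cancel_left) simp
  finally have q: "(1 + (z - a) / (z - cnj a)) / (1 - (z - a) / (z - cnj a))
      = (z - of_real (Re a)) / (\<i> * of_real (Im a))" .
  show "\<psi> ((z - a) / (z - cnj a)) = z"
    unfolding \<psi>_def q using assms by simp
qed

text \<open>Cayley maps centred at a and at f(a) turn f into a self-map of the disc fixing 0, to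
  which the Schwarz lemma applies. After squaring, the inequality has the form A / (A + 4p) \<le> B
  / (B + 4q), and the term AB cancels on clearing denominators.\<close>

lemma half_plane_schwarz_pick_pos:
  assumes hol: "f holomorphic_on upper_half_plane"
    and pos: "\<And>z. Im z > 0 \<Longrightarrow> Im (f z) > 0"
    and z: "Im z > 0" and a: "Im a > 0"
  shows "(norm (f z - f a))\<^sup>2 * (Im z * Im a) \<le> (norm (z - a))\<^sup>2 * (Im (f z) * Im (f a))"
proof -
  define \<psi> where "\<psi> = (\<lambda>\<zeta>. of_real (Re a) + \<i> * of_real (Im a) * ((1 + \<zeta>) / (1 - \<zeta>)))"
  have cayley: "norm \<zeta> < 1 \<Longrightarrow> Im (\<psi> \<zeta>) > 0" "norm ((z - a) / (z - cnj a)) < 1"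
    "\<psi> ((z - a) / (z - cnj a)) = z" for \<zeta>
    using cayley_bij_half_plane[OF a] z by (simp_all add: \<psi>_def)
  define g where "g = (\<lambda>\<zeta>. (f (\<psi> \<zeta>) - f a) / (f (\<psi> \<zeta>) - cnj (f a)))"
  have "\<psi> holomorphic_on ball 0 1"
    unfolding \<psi>_def by (intro holomorphic_intros) auto
  then have "(f \<circ> \<psi>) holomorphic_on ball 0 1"
    by (rule holomorphic_on_compose_gen[OF _ hol]) (auto intro: cayley(1))
  then have f\<psi>: "(\<lambda>\<zeta>. f (\<psi> \<zeta>)) holomorphic_on ball 0 1"
    by (simp add: o_def)
  have nz: "f (\<psi> \<zeta>) - cnj (f a) \<noteq> 0" if "norm \<zeta> < 1" for \<zeta>
    using pos[OF cayley(1)[OF that]] pos[OF a] by (auto simp: complex_eq_iff)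
  have "g holomorphic_on ball 0 1"
    unfolding g_def by (intro holomorphic_intros f\<psi>) (use nz in auto)
  moreover have "g 0 = 0"
    by (simp add: g_def \<psi>_def flip: complex_eq)
  moreover have "norm (g \<zeta>) < 1" if "norm \<zeta> < 1" for \<zeta>
    unfolding g_def by (rule cayley_bij_half_plane(2)[OF pos[OF a] pos[OF cayley(1)[OF that]]])
  ultimately have "norm (g ((z - a) / (z - cnj a))) \<le> norm ((z - a) / (z - cnj a))"
    by (rule Schwarz_Lemma(1)[OF _ _ _ cayley(2)])
  then have le: "norm (f z - f a) / norm (f z - cnj (f a)) \<le> norm (z - a) / norm (z - cnj a)"
    by (simp add: g_def cayley(3) norm_divide)
  define A B where "A = (norm (f z - f a))\<^sup>2" and "B = (norm (z - a))\<^sup>2"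
  define p q where "p = Im (f z) * Im (f a)" and "q = Im z * Im a"
  have p: "p > 0" and q: "q > 0" using pos z a by (simp_all add: p_def q_def)
  have AB: "A \<ge> 0" "B \<ge> 0" by (simp_all add: A_def B_def)
  have "(norm (f z - f a) / norm (f z - cnj (f a)))\<^sup>2 \<le> (norm (z - a) / norm (z - cnj a))\<^sup>2"
    using le by (rule power_mono) simp
  then have "A / (A + 4 * p) \<le> B / (B + 4 * q)"
    by (simp only: power_divide norm_diff_cnj_sq A_def B_def p_def q_def)
  moreover have "A + 4 * p > 0" "B + 4 * q > 0" using p q AB by linarith+
  ultimately have "A * (B + 4 * q) \<le> B * (A + 4 * p)"
    by (simp add: frac_le_eq divide_le_eq pos_le_divide_eq mult.commute)
  then have "A * q \<le> B * p" by (simp add: algebra_simps)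
  then show ?thesis by (simp add: A_def B_def p_def q_def)
qed

text \<open>Adding \<i>\<delta> makes the imaginary part positive, and the product form is
  continuous as \<delta> tends to 0. The closed version is what F - id requires: for a point mass it
  is a real constant. It also shows that a function with vanishing imaginary part is
  constant.\<close>

lemma half_plane_schwarz_pick:
  assumes hol: "f holomorphic_on upper_half_plane"
    and nonneg: "\<And>z. Im z > 0 \<Longrightarrow> Im (f z) \<ge> 0"
    and z: "Im z > 0" and a: "Im a > 0"
  shows "(norm (f z - f a))\<^sup>2 * (Im z * Im a) \<le> (norm (z - a))\<^sup>2 * (Im (f z) * Im (f a))"
proof (rule tendsto_lowerbound)
  show "((\<lambda>\<delta>. (norm (z - a))\<^sup>2 * ((Im (f z) + \<delta>) * (Im (f a) + \<delta>))) \<longlongrightarrow>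
      (norm (z - a))\<^sup>2 * (Im (f z) * Im (f a))) (at_right 0)"
    by (auto intro!: tendsto_eq_intros)
  show "\<forall>\<^sub>F \<delta> in at_right 0. (norm (f z - f a))\<^sup>2 * (Im z * Im a)
      \<le> (norm (z - a))\<^sup>2 * ((Im (f z) + \<delta>) * (Im (f a) + \<delta>))"
    using eventually_at_right_less[of 0]
  proof eventually_elim
    case (elim \<delta>)
    have "(\<lambda>z. f z + \<i> * of_real \<delta>) holomorphic_on upper_half_plane"
      by (intro holomorphic_intros hol)
    from half_plane_schwarz_pick_pos[OF this _ z a] show ?case
      using elim by (simp add: add_nonneg_pos nonneg)
  qed
qed simp

text \<open>Equal images give |z - w| = |c| |K(z) - K(w)|. For distinct points Schwarz-Pick would
  then bound Im z Im w by (|c| Im K(z)) (|c| Im K(w)), which is strictly smaller on this set. For c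
  \<le> 0 the set is the preimage of the upper half-plane.\<close>

lemma inj_on_perturbed_identity:
  fixes c :: real
  assumes hol: "K holomorphic_on upper_half_plane"
    and nonneg: "\<And>z. Im z > 0 \<Longrightarrow> Im (K z) \<ge> 0"
  shows "inj_on (\<lambda>z. z + of_real c * K z) {z. 0 < Im z \<and> \<bar>c\<bar> * Im (K z) < Im z}"
proof (rule inj_onI, clarsimp)
  fix z w
  assume z: "0 < Im z" "\<bar>c\<bar> * Im (K z) < Im z" and w: "0 < Im w" "\<bar>c\<bar> * Im (K w) < Im w"
    and eq: "z + of_real c * K z = w + of_real c * K w"
  show "z = w"
  proof (rule ccontr)
    assume "z \<noteq> w"
    then have nz: "(norm (z - w))\<^sup>2 > 0" by simp
    have "z - w = - of_real c * (K z - K w)"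
      using eq by (simp add: algebra_simps)
    then have e: "(norm (z - w))\<^sup>2 = c\<^sup>2 * (norm (K z - K w))\<^sup>2"
      by (simp only: norm_mult power_mult_distrib norm_minus_cancel norm_of_real power2_abs)
    have "(norm (z - w))\<^sup>2 * (Im z * Im w) = c\<^sup>2 * ((norm (K z - K w))\<^sup>2 * (Im z * Im w))"
      unfolding e by simp
    also have "\<dots> \<le> c\<^sup>2 * ((norm (z - w))\<^sup>2 * (Im (K z) * Im (K w)))"
      by (intro mult_left_mono half_plane_schwarz_pick hol nonneg z w) auto
    also have "\<dots> = (norm (z - w))\<^sup>2 * ((\<bar>c\<bar> * Im (K z)) * (\<bar>c\<bar> * Im (K w)))"
      by (simp add: power2_eq_square abs_mult_self_eq algebra_simps)
    also have "\<dots> < (norm (z - w))\<^sup>2 * (Im z * Im w)"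
      using z w nonneg nz by (intro mult_strict_left_mono mult_strict_mono') auto
    finally show False by simp
  qed
qed

subsection \<open>Global inverses of perturbations of the identity\<close>

text \<open>The heights enter Schwarz-Pick as a product, so a factor 4 of room at the single point
  w0 suffices: after the square root, c |K(w) - K(w0)| is at most |w - w0| / 2 and can be absorbed.
  The point w may approach the boundary of the preimage.\<close>

lemma perturbed_identity_expansive:
  fixes c :: real
  assumes hol: "K holomorphic_on upper_half_plane"
    and nonneg: "\<And>z. Im z > 0 \<Longrightarrow> Im (K z) \<ge> 0"
    and c: "c \<ge> 0"
    and w: "Im w > 0" "c * Im (K w) \<le> Im w"
    and w0: "Im w0 > 0" "4 * c * Im (K w0) \<le> Im w0"
  shows "norm (w - w0) \<le> 2 * norm ((w - of_real c * K w) - (w0 - of_real c * K w0))"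
proof -
  have "(c * norm (K w - K w0))\<^sup>2 * (Im w * Im w0) = c\<^sup>2 * ((norm (K w - K w0))\<^sup>2 * (Im w * Im w0))"
    by (simp add: power_mult_distrib)
  also have "\<dots> \<le> c\<^sup>2 * ((norm (w - w0))\<^sup>2 * (Im (K w) * Im (K w0)))"
    by (intro mult_left_mono half_plane_schwarz_pick hol nonneg w w0) auto
  also have "\<dots> = (norm (w - w0))\<^sup>2 * ((c * Im (K w)) * (c * Im (K w0)))"
    by (simp add: power2_eq_square algebra_simps)
  also have "\<dots> \<le> (norm (w - w0))\<^sup>2 * (Im w * (Im w0 / 4))"
    using w w0 c by (intro mult_left_mono mult_mono) (auto simp: nonneg)
  also have "\<dots> = (norm (w - w0) / 2)\<^sup>2 * (Im w * Im w0)"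
    by (simp add: power_divide)
  finally have "(c * norm (K w - K w0))\<^sup>2 \<le> (norm (w - w0) / 2)\<^sup>2"
    using w(1) w0(1) by (simp add: mult_le_cancel_right)
  then have "c * norm (K w - K w0) \<le> norm (w - w0) / 2"
    by (rule power2_le_imp_le) simp
  moreover have "norm (w - w0) \<le> norm ((w - of_real c * K w) - (w0 - of_real c * K w0)) + c * norm (K w - K w0)"
  proof -
    have "w - w0 = ((w - of_real c * K w) - (w0 - of_real c * K w0)) + of_real c * (K w - K w0)"
      by (simp add: algebra_simps)
    then have "norm (w - w0) \<le> norm ((w - of_real c * K w) - (w0 - of_real c * K w0)) + norm (of_real c * (K w - K w0))"
      by (metis norm_triangle_ineq)
    then show ?thesis using c by (simp add: norm_mult)
  qed
  ultimately show ?thesis by linarith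
qed

text \<open>
  The map \<open>h(w) = w - c K(w)\<close> is injective on the preimage \<open>U\<close> of the upper half-plane. Comparing with a
  reference point \<open>iY\<close> shows that it is also proper there, so \<open>h(U)\<close> is open and closed in the upper half-plane.
\<close>

lemma perturbed_identity_global_inverse:
  fixes c :: real
  assumes hol: "K holomorphic_on upper_half_plane"
    and nonneg: "\<And>z. Im z > 0 \<Longrightarrow> Im (K z) \<ge> 0"
    and lim: "((\<lambda>y. norm (K (\<i> * of_real y)) / y) \<longlongrightarrow> 0) at_top"
    and c: "c \<ge> 0"
  obtains \<omega> where "\<omega> holomorphic_on upper_half_plane"
    and "\<And>z. Im z > 0 \<Longrightarrow> Im z \<le> Im (\<omega> z)"
    and "\<And>z. Im z > 0 \<Longrightarrow> \<omega> z - of_real c * K (\<omega> z) = z"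
    and "\<And>w. Im w > 0 \<Longrightarrow> Im (w - of_real c * K w) > 0 \<Longrightarrow> \<omega> (w - of_real c * K w) = w"
    and "((\<lambda>y. norm (\<omega> (\<i> * of_real y) - \<i> * of_real y) / y) \<longlongrightarrow> 0) at_top"
proof -
  define h where "h w = w - of_real c * K w" for w
  define U where "U = {w \<in> upper_half_plane. h w \<in> upper_half_plane}"
  have holh: "h holomorphic_on upper_half_plane"
    unfolding h_def by (intro holomorphic_intros hol)
  have contU: "continuous_on upper_half_plane h"
    by (rule holomorphic_on_imp_continuous_on[OF holh])
  have U_eq: "U = {z. 0 < Im z \<and> \<bar>- c\<bar> * Im (K z) < Im z}"
    using c by (auto simp: U_def h_def)
  have openU: "open U"
    using continuous_open_preimage[OF contU, of upper_half_plane]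
    by (simp add: U_def vimage_def Int_def)
  have subU: "U \<subseteq> upper_half_plane" by (auto simp: U_def)
  have injU: "inj_on h U"
    using inj_on_perturbed_identity[OF hol nonneg, of "- c"] by (simp add: U_eq h_def [abs_def])
  have holU: "h holomorphic_on U"
    using holh subU by (rule holomorphic_on_subset)
  have Im_h: "Im (h w) \<le> Im w" if "Im w > 0" for w
    using c nonneg[OF that] by (simp add: h_def)
  \<comment> \<open>Sublinear growth of K makes every high point of the imaginary axis an admissible
    reference point. One fixed such point yields properness; a moving one yields the asymptotics of
    the inverse.\<close>
  have small: "\<forall>\<^sub>F y in at_top. 4 * c * Im (K (\<i> * of_real y)) \<le> y \<and> y > 0"
  proof -
    have "((\<lambda>y. 4 * c * (norm (K (\<i> * of_real y)) / y)) \<longlongrightarrow> 4 * c * 0) at_top"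
      by (intro tendsto_intros lim)
    then have "\<forall>\<^sub>F y in at_top. 4 * c * (norm (K (\<i> * of_real y)) / y) < 1"
      by (rule order_tendstoD) simp
    with eventually_gt_at_top[of 0] show ?thesis
    proof eventually_elim
      case (elim y)
      have "4 * c * Im (K (\<i> * of_real y)) \<le> 4 * c * norm (K (\<i> * of_real y))"
        using c abs_Im_le_cmod[of "K (\<i> * of_real y)"] by (intro mult_left_mono) auto
      also have "\<dots> \<le> y" using elim by (simp add: field_simps)
      finally show ?case using elim by simp
    qed
  qed
  have expansive: "norm (w - \<i> * of_real y) \<le> 2 * norm (h w - h (\<i> * of_real y))"
    if "w \<in> U" "4 * c * Im (K (\<i> * of_real y)) \<le> y \<and> y > 0" for w y
    unfolding h_def
    by (rule perturbed_identity_expansive[OF hol nonneg c]) (use that c in \<open>auto simp: U_eq\<close>)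
  obtain Y where Y: "4 * c * Im (K (\<i> * of_real Y)) \<le> Y \<and> Y > 0"
    using small by (auto simp: eventually_at_top_linorder)
  have "c * Im (K (\<i> * of_real Y)) < Y"
  proof -
    have "c * Im (K (\<i> * of_real Y)) \<ge> 0" using c Y by (simp add: nonneg)
    then show ?thesis using Y by linarith
  qed
  then have "\<i> * of_real Y \<in> U" using Y c by (simp add: U_eq)
  then have ne: "h ` U \<noteq> {}" by blast
  have op: "open (h ` U)"
    by (rule open_mapping_thm3[OF holU openU injU])
  have sub: "h ` U \<subseteq> upper_half_plane" by (auto simp: U_def)
  \<comment> \<open>Expansiveness bounds the preimages of a convergent sequence of images, so a
    subsequence converges to some l. As h does not raise imaginary parts, Im l \<ge> Im z > 0, and l
    cannot fall on the real axis.\<close>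
  have cl: "z \<in> h ` U" if z: "Im z > 0" "z \<in> closure (h ` U)" for z
  proof -
    obtain f where f: "\<forall>n. f n \<in> h ` U" "f \<longlonglongrightarrow> z"
      using z(2) by (auto simp: closure_sequential)
    define w where "w n = inv_into U h (f n)" for n
    have w: "w n \<in> U" "f n = h (w n)" for n
      using f(1) by (simp_all add: w_def inv_into_into f_inv_into_f)
    have lim_h: "(\<lambda>n. h (w n)) \<longlonglongrightarrow> z" using f(2) by (simp flip: w(2))
    have "Bseq (\<lambda>n. h (w n))" by (rule convergent_imp_Bseq[OF convergentI[OF lim_h]])
    then obtain B where B: "0 < B" "\<forall>n. norm (h (w n)) \<le> B" by (rule BseqE)
    let ?i = "\<i> * of_real Y :: complex"
    have bd: "w n \<in> cball ?i (2 * (B + norm (h ?i)))" for n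
    proof -
      have "norm (w n - ?i) \<le> 2 * norm (h (w n) - h ?i)"
        by (rule expansive[OF w(1) Y])
      also have "\<dots> \<le> 2 * (B + norm (h ?i))"
        using norm_triangle_ineq4[of "h (w n)" "h ?i"] B(2)[rule_format, of n] by simp
      finally show ?thesis by (simp add: dist_norm norm_minus_commute)
    qed
    have "seq_compact (cball ?i (2 * (B + norm (h ?i))))"
      by (rule compact_imp_seq_compact[OF compact_cball])
    then obtain l r where r: "strict_mono (r :: nat \<Rightarrow> nat)" "(w \<circ> r) \<longlonglongrightarrow> l"
      using bd by (elim seq_compactE[where f = w]) auto
    have h_lim: "(\<lambda>n. h (w (r n))) \<longlonglongrightarrow> z"
      using LIMSEQ_subseq_LIMSEQ[OF lim_h r(1)] by (simp add: o_def)
    have "Im z \<le> Im l"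
    proof (rule LIMSEQ_le)
      show "(\<lambda>n. Im (h (w (r n)))) \<longlonglongrightarrow> Im z" by (intro tendsto_intros h_lim)
      show "(\<lambda>n. Im (w (r n))) \<longlonglongrightarrow> Im l" using r(2) by (intro tendsto_intros) (simp add: o_def)
      show "\<exists>N. \<forall>n\<ge>N. Im (h (w (r n))) \<le> Im (w (r n))"
        using w(1) by (auto simp: U_def intro!: Im_h)
    qed
    then have l: "l \<in> upper_half_plane" using z by simp
    then have "isCont h l"
      using contU by (simp add: continuous_on_eq_continuous_at)
    then have "(\<lambda>n. h ((w \<circ> r) n)) \<longlonglongrightarrow> h l"
      using r(2) by (rule isCont_tendsto_compose)
    then have "h l = z" using LIMSEQ_unique[OF h_lim, of "h l"] by (simp add: o_def)
    then show ?thesis using l z by (auto simp: U_def)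
  qed
  have surj: "h ` U = upper_half_plane"
  proof -
    have "openin (top_of_set upper_half_plane) (h ` U)"
      using op sub by (simp add: openin_open_eq)
    moreover have "closedin (top_of_set upper_half_plane) (h ` U)"
    proof -
      have "h ` U = upper_half_plane \<inter> closure (h ` U)"
        using cl sub closure_subset[of "h ` U"] by auto
      then show ?thesis using closedin_closed_Int[OF closed_closure] by metis
    qed
    ultimately show ?thesis
      using connected_upper_half_plane ne unfolding connected_clopen by blast
  qed
  obtain \<omega> where \<omega>: "\<omega> holomorphic_on h ` U" "\<And>w. w \<in> U \<Longrightarrow> \<omega> (h w) = w"
    using holomorphic_has_inverse[OF holU openU injU] by metis
  have inv: "\<omega> z \<in> U" "h (\<omega> z) = z" if "Im z > 0" for z
  proof -
    have "z \<in> h ` U" using that surj by simp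
    then obtain w where "w \<in> U" "z = h w" by blast
    then show "\<omega> z \<in> U" "h (\<omega> z) = z" using \<omega>(2) by auto
  qed
  show thesis
  proof (rule that[of \<omega>])
    show "\<omega> holomorphic_on upper_half_plane" using \<omega>(1) surj by simp
    show "Im z \<le> Im (\<omega> z)" if "Im z > 0" for z
      using Im_h[of "\<omega> z"] inv[OF that] subU by auto
    show "\<omega> z - of_real c * K (\<omega> z) = z" if "Im z > 0" for z
      using inv(2)[OF that] by (simp add: h_def)
    show "\<omega> (w - of_real c * K w) = w" if "Im w > 0" "Im (w - of_real c * K w) > 0" for w
      using \<omega>(2)[of w] that by (simp add: U_def h_def)
    \<comment> \<open>The reference point is iy itself: the images of \<omega>(iy) and iy under h
      differ by exactly c K(iy).\<close>
    show "((\<lambda>y. norm (\<omega> (\<i> * of_real y) - \<i> * of_real y) / y) \<longlongrightarrow> 0) at_top"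
    proof (rule Lim_null_comparison)
      have "((\<lambda>y. 2 * c * (norm (K (\<i> * of_real y)) / y)) \<longlongrightarrow> 2 * c * 0) at_top"
        by (intro tendsto_intros lim)
      then show "((\<lambda>y. 2 * c * (norm (K (\<i> * of_real y)) / y)) \<longlongrightarrow> 0) at_top" by simp
      show "\<forall>\<^sub>F y in at_top. norm (norm (\<omega> (\<i> * of_real y) - \<i> * of_real y) / y)
          \<le> 2 * c * (norm (K (\<i> * of_real y)) / y)"
        using small
      proof eventually_elim
        case (elim y)
        have y: "Im (\<i> * of_real y) > 0" using elim by simp
        have "norm (\<omega> (\<i> * of_real y) - \<i> * of_real y)
            \<le> 2 * norm (h (\<omega> (\<i> * of_real y)) - h (\<i> * of_real y))"
          by (rule expansive[OF inv(1)[OF y] elim])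
        also have "h (\<omega> (\<i> * of_real y)) - h (\<i> * of_real y) = of_real c * K (\<i> * of_real y)"
          unfolding inv(2)[OF y] by (simp add: h_def)
        finally show ?case
          using elim c by (simp add: norm_mult divide_right_mono)
      qed
    qed
  qed
qed

subsection \<open>The Poisson integral\<close>

lemma has_bochner_integral_poisson_kernel:
  fixes x y :: real
  assumes "y > 0"
  shows "has_bochner_integral lborel (\<lambda>s. y / ((s - x)\<^sup>2 + y\<^sup>2)) pi"
proof -
  have "integrable lborel (\<lambda>u::real. inverse (1 + u\<^sup>2))" "(LINT u|lborel. inverse (1 + u\<^sup>2)) = pi"
    using integrable_inverse_1_plus_square LBINT_inverse_1_plus_square
    by (simp_all add: set_integrable_def interval_lebesgue_integral_def set_lebesgue_integral_def)
  then have u: "has_bochner_integral lborel (\<lambda>u::real. inverse (1 + u\<^sup>2)) pi"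
    by (simp add: has_bochner_integral_iff)
  have "has_bochner_integral lborel (\<lambda>s. inverse (1 + (- x / y + (1 / y) * s)\<^sup>2)) (pi /\<^sub>R \<bar>1 / y\<bar>)"
    using u assms by (subst lborel_has_bochner_integral_real_affine_iff[symmetric]) auto
  then have "has_bochner_integral lborel (\<lambda>s. (1 / y) * inverse (1 + (- x / y + (1 / y) * s)\<^sup>2)) ((1 / y) * (pi /\<^sub>R \<bar>1 / y\<bar>))"
    by (rule has_bochner_integral_mult_right)
  moreover have "(1 / y) * (pi /\<^sub>R \<bar>1 / y\<bar>) = pi" using assms by simp
  moreover have "(1 / y) * inverse (1 + (- x / y + (1 / y) * s)\<^sup>2) = y / ((s - x)\<^sup>2 + y\<^sup>2)" for s
  proof -
    have "(- x / y + (1 / y) * s)\<^sup>2 = (s - x)\<^sup>2 / y\<^sup>2"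
      using assms by (simp add: power_divide diff_divide_distrib flip: power_divide)
    then have "1 + (- x / y + (1 / y) * s)\<^sup>2 = ((s - x)\<^sup>2 + y\<^sup>2) / y\<^sup>2"
      using assms by (simp add: add_divide_distrib)
    then show ?thesis using assms by (simp add: power2_eq_square)
  qed
  ultimately show ?thesis by (simp only:)
qed

text \<open>
  Cauchy's theorem on half discs is applied to \<open>(g(s) - g(z)) / ((s - z)(s - cnj z))\<close>, whose singularity
  at \<open>z\<close> is removable. As \<open>g\<close> is bounded, the contribution of the arc is \<open>O(1/R)\<close>.
\<close>

lemma poisson_half_plane:
  fixes g :: "complex \<Rightarrow> complex"
  assumes hol: "g holomorphic_on {z. Im z > - e}" and e: "e > 0"
    and B: "\<And>z. Im z > - e \<Longrightarrow> norm (g z) \<le> B"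
    and y: "y > 0"
  shows "has_bochner_integral lborel (\<lambda>s. (y / ((s - x)\<^sup>2 + y\<^sup>2)) *\<^sub>R g (of_real s)) (pi *\<^sub>R g (Complex x y))"
proof -
  define z where "z = Complex x y"
  define p where "p s = y / ((s - x)\<^sup>2 + y\<^sup>2)" for s
  define q where "q w = (if w = z then deriv g z else (g w - g z) / (w - z))" for w
  define k where "k w = q w / (w - cnj z)" for w
  \<comment> \<open>The half-plane above -\<delta> lies in the domain of g and avoids the pole cnj
    z, which sits at height -y.\<close>
  define \<delta> where "\<delta> = min e y"
  have den: "(s - x)\<^sup>2 + y\<^sup>2 > 0" for s using y by (intro add_nonneg_pos) auto
  have p0: "p s \<ge> 0" for s using y den[of s] by (simp add: p_def less_imp_le)
  have B0: "B \<ge> 0" using B[of 0] e norm_ge_zero[of "g 0"] by (simp del: norm_ge_zero)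
  have gB: "norm (g (of_real s)) \<le> B" for s using B[of "of_real s"] e by simp
  have gz: "norm (g z) \<le> B" using B[of z] e y by (simp add: z_def)
  have holq: "q holomorphic_on {w. Im w > - e}"
    unfolding q_def [abs_def] by (rule pole_lemma_open[OF hol open_halfspace_Im_gt])
  have holk: "k holomorphic_on {w. Im w > - \<delta>}"
    unfolding k_def [abs_def]
  proof (intro holomorphic_intros)
    show "q holomorphic_on {w. - \<delta> < Im w}"
      by (rule holomorphic_on_subset[OF holq]) (auto simp: \<delta>_def)
    show "w - cnj z \<noteq> 0" if "w \<in> {w. - \<delta> < Im w}" for w
      using that by (auto simp: \<delta>_def z_def complex_eq_iff)
  qed
  have k_real: "k (of_real s) = (g (of_real s) - g z) / of_real ((s - x)\<^sup>2 + y\<^sup>2)" for s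
  proof -
    have ne: "of_real s \<noteq> z" using y by (auto simp: z_def complex_eq_iff)
    have "(of_real s - z) * (of_real s - cnj z) = of_real ((s - x)\<^sup>2 + y\<^sup>2)"
      by (simp add: z_def complex_eq_iff power2_eq_square algebra_simps)
    then show ?thesis using ne by (simp add: k_def q_def)
  qed
  \<comment> \<open>As p integrates to pi, the Poisson formula reduces to the vanishing of the
    integral of k over the real line.\<close>
  have pk: "y *\<^sub>R k (of_real s) = p s *\<^sub>R (g (of_real s) - g z)" for s
    by (simp add: k_real p_def scaleR_conv_of_real)
  have cont_g: "continuous_on UNIV (\<lambda>s::real. g (of_real s))"
    by (rule continuous_on_compose2[OF holomorphic_on_imp_continuous_on[OF hol]])
       (use e in \<open>auto intro!: continuous_intros\<close>)
  have cont_k: "continuous_on UNIV (\<lambda>s::real. k (of_real s))"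
    by (rule continuous_on_compose2[OF holomorphic_on_imp_continuous_on[OF holk]])
       (use e y in \<open>auto intro!: continuous_intros simp: \<delta>_def\<close>)
  have [measurable]: "(\<lambda>s::real. g (of_real s)) \<in> borel_measurable borel"
    "(\<lambda>s::real. k (of_real s)) \<in> borel_measurable borel"
    using cont_g cont_k by (simp_all add: borel_measurable_continuous_onI)
  have p_int: "integrable lborel p" "(LINT s|lborel. p s) = pi"
    using has_bochner_integral_poisson_kernel[OF y, of x]
    by (simp_all add: p_def [abs_def] has_bochner_integral_iff)
  have k_bound: "norm (k (of_real s)) \<le> (2 * B / y) * p s" for s
  proof -
    have "norm (g (of_real s) - g z) \<le> 2 * B"
      using norm_triangle_ineq4[of "g (of_real s)" "g z"] gB[of s] gz by simp
    then have "norm (g (of_real s) - g z) / ((s - x)\<^sup>2 + y\<^sup>2) \<le> 2 * B / ((s - x)\<^sup>2 + y\<^sup>2)"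
      using den[of s] by (intro divide_right_mono) auto
    moreover have "norm (k (of_real s)) = norm (g (of_real s) - g z) / ((s - x)\<^sup>2 + y\<^sup>2)"
      unfolding k_real norm_divide norm_of_real using den[of s] by simp
    ultimately show ?thesis using y by (simp add: p_def)
  qed
  have int_k: "integrable lborel (\<lambda>s. k (of_real s))"
  proof (rule Bochner_Integration.integrable_bound)
    show "integrable lborel (\<lambda>s. (2 * B / y) * p s)"
      using p_int(1) by (rule integrable_mult_right)
    show "AE s in lborel. norm (k (of_real s)) \<le> norm ((2 * B / y) * p s)"
    proof (rule AE_I2)
      fix s
      have "(2 * B / y) * p s \<ge> 0" using B0 y p0 by simp
      then show "norm (k (of_real s)) \<le> norm ((2 * B / y) * p s)"
        using k_bound[of s] by (simp only: real_norm_def abs_of_nonneg)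
    qed
  qed simp
  have arc: "norm (LINT s|lborel. indicator {-R..R} s *\<^sub>R k (of_real s)) \<le> 8 * pi * B / R"
    if R: "R \<ge> 2 * norm z + 2" for R
  proof -
    have "0 < 2 * norm z + 2" using norm_ge_zero[of z] by linarith
    then have "R > 0" using R by (rule less_le_trans)
    moreover have "R \<ge> 2 * norm z" using R by linarith
    ultimately have R0: "R > 0" "R \<ge> 2 * norm z" .
    let ?l = "linepath (complex_of_real (-R)) (complex_of_real R)"
    let ?a = "part_circlepath 0 R 0 pi"
    have im: "path_image ?a \<subseteq> {w. Im w > - \<delta>} \<inter> sphere 0 R"
    proof
      fix w assume "w \<in> path_image ?a"
      then obtain t where t: "0 \<le> t" "t \<le> pi" "w = R * cis t"
        using R0 by (auto simp: path_image_part_circlepath cis_conv_exp)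
      then have "Im w \<ge> 0" using R0 by (simp add: sin_ge_zero)
      moreover have "norm w = R" using t R0 by (simp add: norm_mult)
      moreover have "\<delta> > 0" using e y by (simp add: \<delta>_def)
      ultimately show "w \<in> {w. Im w > - \<delta>} \<inter> sphere 0 R" by simp
    qed
    have \<delta>0: "\<delta> > 0" using e y by (simp add: \<delta>_def)
    have cl: "(k has_contour_integral 0) (?l +++ ?a)"
    proof (rule Cauchy_theorem_convex_simple[OF holk convex_halfspace_Im_gt])
      show "valid_path (?l +++ ?a)"
        by (intro valid_path_join valid_path_linepath valid_path_part_circlepath) simp
      have "path_image ?l \<subseteq> {w. Im w > - \<delta>}"
        using \<delta>0 by (auto simp: path_image_linepath closed_segment_def)
      then show "path_image (?l +++ ?a) \<subseteq> {w. Im w > - \<delta>}"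
        using im path_image_join_subset[of ?l ?a] by blast
      show "pathfinish (?l +++ ?a) = pathstart (?l +++ ?a)"
        by (simp add: exp_pi_i')
    qed
    have contk: "continuous_on {w. Im w > - \<delta>} k" by (rule holomorphic_on_imp_continuous_on[OF holk])
    have ci: "k contour_integrable_on ?a"
      by (rule contour_integrable_continuous_part_circlepath, rule continuous_on_subset[OF contk])
         (use im in blast)
    have hl: "(k has_contour_integral (- contour_integral ?a k)) ?l"
    proof -
      have il: "k contour_integrable_on ?l"
        by (rule contour_integrable_continuous_linepath, rule continuous_on_subset[OF contk])
           (use \<delta>0 in \<open>auto simp: closed_segment_def\<close>)
      have "contour_integral ?l k + contour_integral ?a k = 0"
        using contour_integral_unique[OF cl] il ci by (simp add: valid_path_part_circlepath)
      then have "contour_integral ?l k = - contour_integral ?a k"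
        by (simp add: add_eq_0_iff2)
      then show ?thesis using has_contour_integral_integral[OF il] by simp
    qed
    then have "((\<lambda>s. k (of_real s)) has_integral (- contour_integral ?a k)) {-R..R}"
      using R0 by (subst (asm) has_contour_integral_linepath_Reals_iff) auto
    then have "integral {-R..R} (\<lambda>s. k (of_real s)) = - contour_integral ?a k"
      by (rule integral_unique)
    moreover have "(LINT s:{-R..R}|lborel. k (of_real s)) = integral {-R..R} (\<lambda>s. k (of_real s))"
      by (rule set_borel_integral_eq_integral(2), rule borel_integrable_atLeastAtMost',
          rule continuous_on_subset[OF cont_k]) simp
    \<comment> \<open>On the arc both linear factors are at least R / 2, because R \<ge> 2 |z|, and
      the numerator is at most 2B; the arc has length pi R.\<close>
    moreover have "norm (contour_integral ?a k) \<le> (8 * B / R\<^sup>2) * R * (pi - 0)"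
    proof (rule has_contour_integral_bound_part_circlepath[OF has_contour_integral_integral[OF ci]])
      fix w assume "w \<in> path_image ?a"
      then have w: "Im w > - \<delta>" "norm w = R" using im by auto
      have d: "norm (w - z) \<ge> R / 2" "norm (w - cnj z) \<ge> R / 2"
        using norm_triangle_ineq2[of w z] norm_triangle_ineq2[of w "cnj z"] w R0 by simp_all
      have "Im w > - e" using w by (simp add: \<delta>_def)
      then have "norm (g w - g z) \<le> 2 * B"
        using norm_triangle_ineq4[of "g w" "g z"] B[of w] gz by simp
      moreover have "norm (w - z) * norm (w - cnj z) \<ge> R / 2 * (R / 2)"
        using d R0 by (intro mult_mono) auto
      ultimately have "norm (g w - g z) / (norm (w - z) * norm (w - cnj z)) \<le> 2 * B / (R / 2 * (R / 2))"
        using R0 B0 by (intro frac_le) auto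
      moreover have "w \<noteq> z" using d R0 by auto
      then have "norm (k w) = norm (g w - g z) / (norm (w - z) * norm (w - cnj z))"
        by (simp add: k_def q_def norm_divide norm_mult)
      ultimately show "norm (k w) \<le> 8 * B / R\<^sup>2"
        by (simp add: power2_eq_square)
    qed (use R0 B0 in auto)
    ultimately show ?thesis using R0
      by (simp add: set_lebesgue_integral_def power2_eq_square mult_ac)
  qed
  have "(\<lambda>n. LINT s|lborel. indicator {-real n..real n} s *\<^sub>R k (of_real s)) \<longlonglongrightarrow> (LINT s|lborel. k (of_real s))"
  proof (rule integral_dominated_convergence[where w="\<lambda>s. norm (k (of_real s))"])
    show "AE s in lborel. (\<lambda>n. indicator {-real n..real n} s *\<^sub>R k (of_real s)) \<longlonglongrightarrow> k (of_real s)"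
    proof (rule AE_I2, rule tendsto_eventually)
      fix s :: real
      obtain N where "\<bar>s\<bar> \<le> real N" using real_arch_simple by blast
      then show "\<forall>\<^sub>F n in sequentially. indicator {-real n..real n} s *\<^sub>R k (of_real s) = k (of_real s)"
        by (intro eventually_sequentiallyI[of N]) (auto simp: indicator_def)
    qed
  qed (use int_k in \<open>auto simp: indicator_def\<close>)
  moreover have "(\<lambda>n. LINT s|lborel. indicator {-real n..real n} s *\<^sub>R k (of_real s)) \<longlonglongrightarrow> 0"
  proof (rule Lim_null_comparison)
    obtain N where N: "2 * norm z + 2 \<le> real N" using real_arch_simple by blast
    show "\<forall>\<^sub>F n in sequentially. norm (LINT s|lborel. indicator {-real n..real n} s *\<^sub>R k (of_real s))
        \<le> 8 * pi * B / real n"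
      by (rule eventually_sequentiallyI[of N], rule arc) (use N in auto)
    show "(\<lambda>n. 8 * pi * B / real n) \<longlonglongrightarrow> 0" by (rule lim_const_over_n)
  qed
  ultimately have k0: "(LINT s|lborel. k (of_real s)) = 0" by (rule LIMSEQ_unique)
  have "has_bochner_integral lborel (\<lambda>s. y *\<^sub>R k (of_real s) + p s *\<^sub>R g z) (y *\<^sub>R 0 + pi *\<^sub>R g z)"
    by (intro has_bochner_integral_add has_bochner_integral_scaleR_right has_bochner_integral_scaleR_left)
       (use int_k k0 p_int in \<open>auto simp: has_bochner_integral_iff\<close>)
  moreover have "y *\<^sub>R k (of_real s) + p s *\<^sub>R g z = p s *\<^sub>R g (of_real s)" for s
    unfolding pk by (simp add: scaleR_right_diff_distrib)
  ultimately show ?thesis by (simp add: z_def p_def)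
qed

subsection \<open>Existence of measures with a given reciprocal Cauchy transform\<close>

lemma (in real_distribution) Im_cauchy_transform_poisson:
  assumes "y > 0"
  shows "Im (cauchy_transform M (Complex x y)) = - (LINT s|M. y / ((s - x)\<^sup>2 + y\<^sup>2))"
proof -
  have "y * (norm (1 / (Complex x y - complex_of_real s)))\<^sup>2 = y / ((s - x)\<^sup>2 + y\<^sup>2)" for s
    by (simp add: norm_divide power_divide cmod_power2 power2_commute)
  then show ?thesis
    using assms by (subst Im_cauchy_transform) (simp_all flip: integral_mult_right_zero)
qed

text \<open>Shifting upwards by \<epsilon> gives G bounded, continuous boundary values, so -Im / pi
  along the shifted line is a Poisson density. Only imaginary parts are recovered here; total mass 1
  comes from the limit along the imaginary axis.\<close>

lemma cauchy_transform_of_shift: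
  assumes hol: "G holomorphic_on upper_half_plane"
    and neg: "\<And>z. Im z > 0 \<Longrightarrow> Im (G z) \<le> 0"
    and bound: "\<And>z. Im z > 0 \<Longrightarrow> norm (G z) \<le> 1 / Im z"
    and lim: "((\<lambda>y. - y * Im (G (\<i> * of_real y))) \<longlongrightarrow> 1) at_top"
    and \<epsilon>: "\<epsilon> > 0"
  obtains \<nu> where "real_distribution \<nu>"
    and "\<And>z. Im z > 0 \<Longrightarrow> Im (cauchy_transform \<nu> z) = Im (G (z + \<i> * of_real \<epsilon>))"
proof -
  define g where "g z = G (z + \<i> * of_real \<epsilon>)" for z
  define f where "f s = - Im (g (of_real s)) / pi" for s
  have "(\<lambda>z. z + \<i> * of_real \<epsilon>) ` {z. Im z > - (\<epsilon> / 2)} \<subseteq> upper_half_plane"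
    using \<epsilon> by auto
  then have "(G \<circ> (\<lambda>z. z + \<i> * of_real \<epsilon>)) holomorphic_on {z. Im z > - (\<epsilon> / 2)}"
    by (intro holomorphic_on_compose_gen[OF _ hol] holomorphic_intros)
  then have holg: "g holomorphic_on {z. Im z > - (\<epsilon> / 2)}"
    by (simp add: g_def [abs_def] o_def)
  have gB: "norm (g z) \<le> 2 / \<epsilon>" if "Im z > - (\<epsilon> / 2)" for z
  proof -
    have z: "Im (z + \<i> * of_real \<epsilon>) \<ge> \<epsilon> / 2" using that by simp
    moreover have "\<epsilon> / 2 > 0" using \<epsilon> by simp
    ultimately have "Im (z + \<i> * of_real \<epsilon>) > 0" by linarith
    then have "norm (g z) \<le> 1 / Im (z + \<i> * of_real \<epsilon>)"
      unfolding g_def by (rule bound)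
    also have "\<dots> \<le> 1 / (\<epsilon> / 2)" using z \<epsilon> by (intro divide_left_mono) auto
    finally show ?thesis by simp
  qed
  have f0: "f s \<ge> 0" for s
    using neg[of "of_real s + \<i> * of_real \<epsilon>"] \<epsilon> by (simp add: f_def g_def divide_nonpos_pos)
  have "continuous_on UNIV (\<lambda>s::real. g (of_real s))"
    by (rule continuous_on_compose2[OF holomorphic_on_imp_continuous_on[OF holg]])
       (use \<epsilon> in \<open>auto intro!: continuous_intros\<close>)
  then have "continuous_on UNIV f"
    unfolding f_def [abs_def] by (intro continuous_intros) auto
  then have [measurable]: "f \<in> borel_measurable borel"
    by (rule borel_measurable_continuous_onI)
  have rep: "has_bochner_integral lborel (\<lambda>s. f s * (y / ((s - x)\<^sup>2 + y\<^sup>2))) (- Im (g (Complex x y)))"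
    if "y > 0" for x y
  proof -
    have "has_bochner_integral lborel (\<lambda>s. Im ((y / ((s - x)\<^sup>2 + y\<^sup>2)) *\<^sub>R g (of_real s))) (Im (pi *\<^sub>R g (Complex x y)))"
      by (rule has_bochner_integral_bounded_linear[OF bounded_linear_Im poisson_half_plane[OF holg _ gB that]])
         (use \<epsilon> in auto)
    then have "has_bochner_integral lborel (\<lambda>s. (- 1 / pi) * Im ((y / ((s - x)\<^sup>2 + y\<^sup>2)) *\<^sub>R g (of_real s)))
        ((- 1 / pi) * Im (pi *\<^sub>R g (Complex x y)))"
      by (rule has_bochner_integral_mult_right)
    moreover have "(- 1 / pi) * Im ((y / ((s - x)\<^sup>2 + y\<^sup>2)) *\<^sub>R g (of_real s)) = f s * (y / ((s - x)\<^sup>2 + y\<^sup>2))" for s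
      by (simp add: f_def)
    moreover have "(- 1 / pi) * Im (pi *\<^sub>R g (Complex x y)) = - Im (g (Complex x y))" by simp
    ultimately show ?thesis by (simp only:)
  qed
  define Y where "Y n = real (Suc n)" for n
  have Y: "Y n > 0" for n by (simp add: Y_def)
  \<comment> \<open>Y times the Poisson integral at iY weights f by Y^2 / (s^2 + Y^2), which
    increases to 1. Monotone convergence thus yields integrability of f and its mass
    together.\<close>
  define u where "u n s = Y n * (f s * (Y n / ((s - 0)\<^sup>2 + (Y n)\<^sup>2)))" for n s
  have u: "has_bochner_integral lborel (u n) (Y n * - Im (g (Complex 0 (Y n))))" for n
    unfolding u_def [abs_def] by (rule has_bochner_integral_mult_right) (rule rep[OF Y])
  have u_eq: "u n s = f s * ((Y n)\<^sup>2 / (s\<^sup>2 + (Y n)\<^sup>2))" for n s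
    by (simp add: u_def power2_eq_square)
  have int_u: "integrable lborel (u n)" for n using u[of n] by (simp add: has_bochner_integral_iff)
  have mono_u: "AE s in lborel. mono (\<lambda>n. u n s)"
  proof (intro AE_I2 monoI)
    fix s and m n :: nat assume "m \<le> n"
    then have le: "(Y m)\<^sup>2 \<le> (Y n)\<^sup>2" by (intro power_mono) (auto simp: Y_def)
    have pos: "s\<^sup>2 + (Y k)\<^sup>2 > 0" for k using Y[of k] by (intro add_nonneg_pos) auto
    have "(Y m)\<^sup>2 * s\<^sup>2 \<le> (Y n)\<^sup>2 * s\<^sup>2" using le by (rule mult_right_mono) simp
    then have "(Y m)\<^sup>2 / (s\<^sup>2 + (Y m)\<^sup>2) \<le> (Y n)\<^sup>2 / (s\<^sup>2 + (Y n)\<^sup>2)"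
      using pos[of m] pos[of n] by (simp add: divide_le_eq pos_le_divide_eq frac_le_eq algebra_simps)
    then show "u m s \<le> u n s" unfolding u_eq by (rule mult_left_mono) (rule f0)
  qed
  have u0: "AE s in lborel. 0 \<le> u n s" for n by (auto simp: u_eq f0)
  have lim_u: "AE s in lborel. (\<lambda>n. u n s) \<longlonglongrightarrow> f s"
  proof (rule AE_I2)
    fix s
    have "(\<lambda>n. (Y n)\<^sup>2 / (s\<^sup>2 + (Y n)\<^sup>2)) \<longlonglongrightarrow> 1"
      unfolding Y_def by real_asymp
    from tendsto_mult_left[OF this, of "f s"] show "(\<lambda>n. u n s) \<longlonglongrightarrow> f s"
      by (simp add: u_eq)
  qed
  \<comment> \<open>The hypothesis is evaluated at height Y + \<epsilon>, where the shifted function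
    samples G; the quotient corrects the prefactor to Y.\<close>
  have "(\<lambda>n. Y n / (Y n + \<epsilon>) * (- (Y n + \<epsilon>) * Im (G (\<i> * of_real (Y n + \<epsilon>))))) \<longlonglongrightarrow> 1 * 1"
  proof (intro tendsto_mult)
    show "(\<lambda>n. Y n / (Y n + \<epsilon>)) \<longlonglongrightarrow> 1" unfolding Y_def by real_asymp
    have "filterlim (\<lambda>n. Y n + \<epsilon>) at_top sequentially" unfolding Y_def by real_asymp
    from filterlim_compose[OF lim this]
    show "(\<lambda>n. - (Y n + \<epsilon>) * Im (G (\<i> * of_real (Y n + \<epsilon>)))) \<longlonglongrightarrow> 1" .
  qed
  moreover have "Y n / (Y n + \<epsilon>) * (- (Y n + \<epsilon>) * Im (G (\<i> * of_real (Y n + \<epsilon>)))) = (LINT s|lborel. u n s)" for n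
  proof -
    have "a / b * (- b * X) = a * - X" if "b > 0" for a b X :: real using that by simp
    moreover have "Y n + \<epsilon> > 0" using Y[of n] \<epsilon> by linarith
    moreover have "Complex 0 (Y n) + \<i> * of_real \<epsilon> = \<i> * of_real (Y n + \<epsilon>)"
      by (simp add: complex_eq_iff)
    then have "g (Complex 0 (Y n)) = G (\<i> * of_real (Y n + \<epsilon>))"
      by (simp only: g_def)
    ultimately show ?thesis
      by (simp only: has_bochner_integral_integral_eq[OF u])
  qed
  ultimately have lim_int: "(\<lambda>n. LINT s|lborel. u n s) \<longlonglongrightarrow> 1" by simp
  have f1: "integrable lborel f" "(LINT s|lborel. f s) = 1"
    by (rule integral_monotone_convergence_nonneg[OF int_u mono_u u0 lim_u lim_int]; simp)+
  define \<nu> where "\<nu> = density lborel f"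
  have dist: "real_distribution \<nu>"
  proof (intro real_distribution.intro real_distribution_axioms.intro prob_spaceI)
    have "emeasure \<nu> (space \<nu>) = (\<integral>\<^sup>+ s. ennreal (f s) \<partial>lborel)"
      by (simp add: \<nu>_def emeasure_density)
    also have "\<dots> = 1"
      using nn_integral_eq_integral[OF f1(1)] f1(2) f0 by simp
    finally show "emeasure \<nu> (space \<nu>) = 1" .
  qed (simp add: \<nu>_def)
  show thesis
  proof (rule that[OF dist])
    fix z assume z: "Im z > 0"
    interpret \<nu>: real_distribution \<nu> by (rule dist)
    have "Im (cauchy_transform \<nu> (Complex (Re z) (Im z))) = - (LINT s|\<nu>. Im z / ((s - Re z)\<^sup>2 + (Im z)\<^sup>2))"
      using z by (rule \<nu>.Im_cauchy_transform_poisson)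
    also have "(LINT s|\<nu>. Im z / ((s - Re z)\<^sup>2 + (Im z)\<^sup>2)) = (LINT s|lborel. f s *\<^sub>R (Im z / ((s - Re z)\<^sup>2 + (Im z)\<^sup>2)))"
      unfolding \<nu>_def by (rule integral_density) (auto simp: f0)
    also have "\<dots> = - Im (g (Complex (Re z) (Im z)))"
      using rep[OF z, of "Re z"] by (simp add: has_bochner_integral_iff)
    finally show "Im (cauchy_transform \<nu> z) = Im (G (z + \<i> * of_real \<epsilon>))"
      by (simp add: g_def)
  qed
qed

text \<open>
  Yields tightness of a family of measures from the behaviour of the Cauchy transforms along the imaginary axis.
\<close>

lemma (in real_distribution) prob_Ioc_ge:
  assumes "y > 0"
  shows "2 * (- y * Im (cauchy_transform M (\<i> * of_real y))) - 1 \<le> measure M {-y<..y}"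
proof -
  have pos: "(s - 0)\<^sup>2 + y\<^sup>2 > 0" for s using assms by (intro add_nonneg_pos) auto
  have int: "integrable M (\<lambda>s. y / ((s - 0)\<^sup>2 + y\<^sup>2))"
  proof (rule integrable_const_bound[where B="1 / y"], rule AE_I2)
    fix s
    have "y / ((s - 0)\<^sup>2 + y\<^sup>2) \<le> y / y\<^sup>2" using assms pos by (intro divide_left_mono) auto
    then show "norm (y / ((s - 0)\<^sup>2 + y\<^sup>2)) \<le> 1 / y"
      using assms pos[of s] by (simp add: power2_eq_square)
  qed simp
  have "\<i> * of_real y = Complex 0 y" by (simp add: complex_eq_iff)
  then have "2 * (- y * Im (cauchy_transform M (\<i> * of_real y))) - 1
      = (2 * y) * (LINT s|M. y / ((s - 0)\<^sup>2 + y\<^sup>2)) - 1"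
    by (simp only: Im_cauchy_transform_poisson[OF assms] mult_minus_right mult_minus_left
        minus_minus mult.assoc)
  also have "\<dots> = (LINT s|M. (2 * y) * (y / ((s - 0)\<^sup>2 + y\<^sup>2)) - 1)"
    by (subst Bochner_Integration.integral_diff[OF integrable_mult_right[OF int] integrable_const])
       (simp_all only: integral_mult_right_zero lebesgue_integral_const prob_UNIV space_eq_univ
         scaleR_one)
  also have "\<dots> \<le> (LINT s|M. indicator {-y<..y} s)"
  proof (rule integral_mono)
    show "integrable M (\<lambda>s. (2 * y) * (y / ((s - 0)\<^sup>2 + y\<^sup>2)) - 1)"
      using int by (intro Bochner_Integration.integrable_diff integrable_mult_right) auto
    fix s :: real
    show "(2 * y) * (y / ((s - 0)\<^sup>2 + y\<^sup>2)) - 1 \<le> indicator {-y<..y} s"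
    \<comment> \<open>The left side is 2 y^2 / (s^2 + y^2) - 1, never above 1 and nonpositive once
      |s| \<ge> y. The excluded endpoint -y falls under the second case.\<close>
    proof (cases "\<bar>s\<bar> < y")
      case True
      have "2 * y * y \<le> 2 * ((s - 0)\<^sup>2 + y\<^sup>2)" by (simp add: power2_eq_square)
      then have "2 * y * y / ((s - 0)\<^sup>2 + y\<^sup>2) \<le> 2" using pos[of s] by (simp only: pos_divide_le_eq)
      moreover have "- y < s" "s \<le> y" using True by auto
      ultimately show ?thesis by (simp add: indicator_def)
    next
      case False
      then have "y\<^sup>2 \<le> s\<^sup>2" using assms by (simp add: abs_le_square_iff[symmetric])
      then have "2 * y * y \<le> 1 * ((s - 0)\<^sup>2 + y\<^sup>2)" by (simp add: power2_eq_square)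
      then have "2 * y * y / ((s - 0)\<^sup>2 + y\<^sup>2) \<le> 1" using pos[of s] by (simp only: pos_divide_le_eq)
      then show ?thesis by (simp add: indicator_def)
    qed
  qed (rule integrable_real_indicator, auto simp: less_top[symmetric])
  finally show ?thesis by simp
qed

theorem recip_cauchy_exists:
  assumes hol: "F holomorphic_on upper_half_plane"
    and ge: "\<And>z. Im z > 0 \<Longrightarrow> Im z \<le> Im (F z)"
    and lim: "((\<lambda>y. norm (F (\<i> * of_real y) - \<i> * of_real y) / y) \<longlongrightarrow> 0) at_top"
  obtains \<nu> where "real_distribution \<nu>" and "\<And>z. Im z > 0 \<Longrightarrow> recip_cauchy \<nu> z = F z"
proof -
  define G where "G z = 1 / F z" for z
  have F0: "F z \<noteq> 0" if "Im z > 0" for z using ge[OF that] that by auto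
  have holG: "G holomorphic_on upper_half_plane"
    unfolding G_def [abs_def] by (intro holomorphic_intros hol) (simp add: F0)
  have neg: "Im (G z) \<le> 0" if "Im z > 0" for z
    using ge[OF that] that by (simp add: G_def Im_divide divide_nonneg_nonneg)
  have bound: "norm (G z) \<le> 1 / Im z" if "Im z > 0" for z
  proof -
    have "Im z \<le> norm (F z)" using ge[OF that] abs_Im_le_cmod[of "F z"] by linarith
    then show ?thesis using that by (simp add: G_def norm_divide frac_le)
  qed
  define T where "T y = - y * Im (G (\<i> * of_real y))" for y
  have T: "(T \<longlongrightarrow> 1) at_top"
  proof -
    have "((\<lambda>y. F (\<i> * of_real y) / (\<i> * of_real y) - 1) \<longlongrightarrow> 0) at_top"
    proof (rule Lim_null_comparison[OF _ lim])
      show "\<forall>\<^sub>F y in at_top. norm (F (\<i> * of_real y) / (\<i> * of_real y) - 1)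
          \<le> norm (F (\<i> * of_real y) - \<i> * of_real y) / y"
        using eventually_gt_at_top[of 0]
      proof eventually_elim
        case (elim y)
        then have "F (\<i> * of_real y) / (\<i> * of_real y) - 1 = (F (\<i> * of_real y) - \<i> * of_real y) / (\<i> * of_real y)"
          by (simp add: diff_divide_distrib)
        then show ?case using elim by (simp add: norm_divide norm_mult)
      qed
    qed
    then have "((\<lambda>y. F (\<i> * of_real y) / (\<i> * of_real y)) \<longlongrightarrow> 1) at_top"
      by (simp only: LIM_zero_iff)
    then have "((\<lambda>y. Re (1 / (F (\<i> * of_real y) / (\<i> * of_real y)))) \<longlongrightarrow> Re (1 / 1)) at_top"
      by (intro tendsto_intros) auto
    moreover have "Re (1 / (F (\<i> * of_real y) / (\<i> * of_real y))) = T y" for y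
    proof -
      have "1 / (F (\<i> * of_real y) / (\<i> * of_real y)) = \<i> * of_real y * G (\<i> * of_real y)"
        by (simp add: G_def)
      then show ?thesis by (simp add: T_def)
    qed
    ultimately show ?thesis by simp
  qed
  define \<epsilon> where "\<epsilon> n = 1 / real (Suc n)" for n
  have \<epsilon>: "\<epsilon> n > 0" "\<epsilon> n \<le> 1" for n by (simp_all add: \<epsilon>_def)
  have \<epsilon>_lim: "\<epsilon> \<longlonglongrightarrow> 0" unfolding \<epsilon>_def by real_asymp
  have "\<exists>\<nu>. real_distribution \<nu> \<and> (\<forall>z. Im z > 0 \<longrightarrow> Im (cauchy_transform \<nu> z) = Im (G (z + \<i> * of_real (\<epsilon> n))))" for n
    using cauchy_transform_of_shift[OF holG neg bound T[unfolded T_def] \<epsilon>(1)[of n]] by metis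
  then obtain \<nu> where \<nu>: "\<And>n. real_distribution (\<nu> n)"
    "\<And>n z. Im z > 0 \<Longrightarrow> Im (cauchy_transform (\<nu> n) z) = Im (G (z + \<i> * of_real (\<epsilon> n)))"
    by metis
  have "tight \<nu>"
    unfolding tight_def
  proof (intro conjI allI impI \<nu>(1))
    fix \<eta> :: real assume \<eta>: "\<eta> > 0"
    \<comment> \<open>Two factors above 1 - \<kappa> give a product of at least 1 - 2 \<kappa>,
      which \<open>prob_Ioc_ge\<close> turns into mass 1 - 4 \<kappa> \<ge> 1 - \<eta> / 2. The
      bound 1/2 keeps the factors positive.\<close>
    define \<kappa> where "\<kappa> = min (\<eta> / 8) (1 / 2)"
    have \<kappa>: "0 < \<kappa>" "\<kappa> < 1" "\<kappa> \<le> \<eta> / 8" using \<eta> by (auto simp: \<kappa>_def)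
    have "((\<lambda>y. y / (y + 1)) \<longlongrightarrow> (1::real)) at_top" by real_asymp
    then have "\<forall>\<^sub>F y in at_top. y / (y + 1) > 1 - \<kappa>" using \<kappa> by (intro order_tendstoD) auto
    moreover have "\<forall>\<^sub>F y in at_top. T y > 1 - \<kappa>" using \<kappa> by (intro order_tendstoD[OF T]) auto
    ultimately have "\<forall>\<^sub>F y in at_top. y / (y + 1) > 1 - \<kappa> \<and> T y > 1 - \<kappa>" by eventually_elim auto
    then obtain Y where Y: "\<And>y. y \<ge> Y \<Longrightarrow> y / (y + 1) > 1 - \<kappa> \<and> T y > 1 - \<kappa>"
      by (auto simp: eventually_at_top_linorder)
    define y where "y = max Y 1"
    have y: "y \<ge> Y" "y > 0" by (auto simp: y_def)
    have "1 - \<eta> < measure (\<nu> n) {-y<..y}" for n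
    proof -
      interpret \<nu>: real_distribution "\<nu> n" by (rule \<nu>(1))
      have p: "y + \<epsilon> n > 0" using y \<epsilon>[of n] by linarith
      have "Im (cauchy_transform (\<nu> n) (\<i> * of_real y)) = Im (G (\<i> * of_real (y + \<epsilon> n)))"
        using \<nu>(2)[of "\<i> * of_real y" n] y by (simp add: algebra_simps)
      then have "- y * Im (cauchy_transform (\<nu> n) (\<i> * of_real y)) = y / (y + \<epsilon> n) * T (y + \<epsilon> n)"
      proof -
        have "y / a * (- a * X) = - y * X" if "a > 0" for a X :: real using that by simp
        from this[OF p] show ?thesis by (simp only: T_def \<open>Im (cauchy_transform _ _) = _\<close>)
      qed
      moreover have "y / (y + \<epsilon> n) * T (y + \<epsilon> n) \<ge> (1 - \<kappa>) * (1 - \<kappa>)"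
      proof (rule mult_mono)
        \<comment> \<open>Using \<epsilon> n \<le> 1 here makes the choice of y uniform in
          n.\<close>
        have "y / (y + 1) \<le> y / (y + \<epsilon> n)" using y p \<epsilon>[of n] by (intro divide_left_mono) auto
        then show "1 - \<kappa> \<le> y / (y + \<epsilon> n)" using Y[OF y(1)] by linarith
        show "1 - \<kappa> \<le> T (y + \<epsilon> n)" using Y[of "y + \<epsilon> n"] y \<epsilon>[of n] by simp
      qed (use \<kappa> y p in auto)
      moreover have "(1 - \<kappa>) * (1 - \<kappa>) \<ge> 1 - 2 * \<kappa>" by (simp add: algebra_simps)
      moreover have "1 - 4 * \<kappa> \<le> b" if "a = p" "c \<le> p" "1 - 2 * \<kappa> \<le> c" "2 * a - 1 \<le> b"
        for a b c p :: real using that by linarith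
      ultimately have "1 - 4 * \<kappa> \<le> measure (\<nu> n) {-y<..y}"
        using \<nu>.prob_Ioc_ge[OF y(2)] by blast
      then show ?thesis using \<kappa> \<eta> by linarith
    qed
    then show "\<exists>a b. a < b \<and> (\<forall>n. 1 - \<eta> < measure (\<nu> n) {a<..b})"
      using y by (intro exI[of _ "-y"] exI[of _ y]) auto
  qed
  from tight_imp_convergent_subsubsequence[OF this strict_mono_id]
  obtain r M where r: "strict_mono (r :: nat \<Rightarrow> nat)" and M: "real_distribution M"
    and wc: "weak_conv_m (\<nu> \<circ> id \<circ> r) M" by blast
  interpret M: real_distribution M by (rule M)
  have Im_eq: "Im (cauchy_transform M z) = Im (G z)" if z: "Im z > 0" for z
  proof (rule LIMSEQ_unique)
    have "(\<lambda>n. cauchy_transform ((\<nu> \<circ> id \<circ> r) n) z) \<longlonglongrightarrow> cauchy_transform M z"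
      unfolding cauchy_transform_def
    \<comment> \<open>For fixed z the Cauchy kernel is bounded and continuous in s, so weak
      convergence passes to Cauchy transforms.\<close>
    proof (rule weak_conv_imp_integral_bdd_continuous_conv[OF _ M wc])
      show "real_distribution ((\<nu> \<circ> id \<circ> r) n)" for n using \<nu>(1) by simp
      show "isCont (\<lambda>s. 1 / (z - complex_of_real s)) x" for x
        using diff_of_real_nonzero[OF z, of x] by (intro continuous_intros) auto
      show "norm (1 / (z - complex_of_real x)) \<le> 1 / Im z" for x
        by (rule norm_cauchy_kernel_le[OF z])
    qed
    then show "(\<lambda>n. Im (cauchy_transform (\<nu> (r n)) z)) \<longlonglongrightarrow> Im (cauchy_transform M z)"
      by (intro tendsto_intros) (simp add: o_def)
    have "isCont G z"
      using holomorphic_on_imp_continuous_on[OF holG] z by (simp add: continuous_on_eq_continuous_at)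
    moreover have "(\<lambda>n. z + \<i> * of_real (\<epsilon> (r n))) \<longlonglongrightarrow> z + \<i> * of_real 0"
      using LIMSEQ_subseq_LIMSEQ[OF \<epsilon>_lim r] by (intro tendsto_intros) (simp add: o_def)
    ultimately have "(\<lambda>n. G (z + \<i> * of_real (\<epsilon> (r n)))) \<longlonglongrightarrow> G z"
      by (intro isCont_tendsto_compose[of z G]) auto
    then show "(\<lambda>n. Im (cauchy_transform (\<nu> (r n)) z)) \<longlonglongrightarrow> Im (G z)"
      unfolding \<nu>(2)[OF z] by (intro tendsto_intros)
  qed
  \<comment> \<open>Only the imaginary parts have been identified. The difference has zero imaginary
    part, so Schwarz-Pick makes it constant, and the bound 1 / Im z on both transforms makes the
    constant zero.\<close>
  define d where "d z = cauchy_transform M z - G z" for z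
  have hold: "d holomorphic_on upper_half_plane"
    unfolding d_def [abs_def] by (intro holomorphic_intros M.holomorphic_cauchy_transform holG)
  have const: "d z = d w" if "Im z > 0" "Im w > 0" for z w
  proof -
    have "(norm (d z - d w))\<^sup>2 * (Im z * Im w) \<le> (norm (z - w))\<^sup>2 * (Im (d z) * Im (d w))"
      by (rule half_plane_schwarz_pick[OF hold _ that]) (simp add: d_def Im_eq)
    moreover have "Im (d z) = 0" using that by (simp add: d_def Im_eq)
    ultimately have "(norm (d z - d w))\<^sup>2 * (Im z * Im w) \<le> 0" by simp
    then have "(norm (d z - d w))\<^sup>2 \<le> 0" using that by (simp add: mult_le_0_iff)
    then show ?thesis by simp
  qed
  have d0: "d z = 0" if z: "Im z > 0" for z
  proof -
    have le: "norm (d z) \<le> 2 / real (Suc n)" for n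
    proof -
      let ?w = "\<i> * of_real (real (Suc n))"
      have w: "Im ?w > 0" by simp
      have "norm (d ?w) \<le> norm (cauchy_transform M ?w) + norm (G ?w)"
        unfolding d_def by (rule norm_triangle_ineq4)
      also have "\<dots> \<le> 1 / Im ?w + 1 / Im ?w"
        by (intro add_mono M.norm_cauchy_transform_le bound w)
      finally show ?thesis unfolding const[OF z w] by simp
    qed
    have "(\<lambda>n. 2 / real (Suc n)) \<longlonglongrightarrow> 0" by real_asymp
    then have "norm (d z) \<le> 0" by (rule LIMSEQ_le_const) (use le in auto)
    then show ?thesis by simp
  qed
  show thesis
  proof (rule that[OF M])
    fix z assume z: "Im z > 0"
    have "cauchy_transform M z = G z" using d0[OF z] by (simp add: d_def)
    then show "recip_cauchy M z = F z" by (simp add: recip_cauchy_def G_def)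
  qed
qed

subsection \<open>Inverses on truncated cones\<close>

text \<open>Collects for K = F - id the hypotheses on K in
  \<open>perturbed_identity_global_inverse\<close>. The limit is the cone estimate restricted to the
  imaginary axis.\<close>

lemma recip_cauchy_minus_id:
  assumes "real_distribution \<mu>"
  shows "(\<lambda>z. recip_cauchy \<mu> z - z) holomorphic_on upper_half_plane"
    and "Im z > 0 \<Longrightarrow> Im (recip_cauchy \<mu> z - z) \<ge> 0"
    and "((\<lambda>y. norm (recip_cauchy \<mu> (\<i> * of_real y) - \<i> * of_real y) / y) \<longlongrightarrow> 0) at_top"
proof -
  interpret real_distribution \<mu> by fact
  show "(\<lambda>z. recip_cauchy \<mu> z - z) holomorphic_on upper_half_plane"
    by (intro holomorphic_intros holomorphic_recip_cauchy)
  show "Im (recip_cauchy \<mu> z - z) \<ge> 0" if "Im z > 0"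
    using Im_recip_cauchy_ge[OF that] by simp
  show "((\<lambda>y. norm (recip_cauchy \<mu> (\<i> * of_real y) - \<i> * of_real y) / y) \<longlongrightarrow> 0) at_top"
  proof (rule tendstoI)
    fix e :: real assume e: "e > 0"
    obtain \<beta> where \<beta>: "\<beta> > 0" "\<forall>z\<in>truncated_cone 1 \<beta>. norm (recip_cauchy \<mu> z - z) \<le> e / 2 * Im z"
      using recip_cauchy_close_on_cone[of 1 "e / 2"] e by auto
    show "\<forall>\<^sub>F y in at_top. dist (norm (recip_cauchy \<mu> (\<i> * of_real y) - \<i> * of_real y) / y) 0 < e"
      using eventually_gt_at_top[of \<beta>]
    proof eventually_elim
      case (elim y)
      then have y: "y > 0" using \<beta>(1) by linarith
      have "\<i> * of_real y \<in> truncated_cone 1 \<beta>"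
        using elim y by (simp add: truncated_cone_def)
      with \<beta>(2) have "norm (recip_cauchy \<mu> (\<i> * of_real y) - \<i> * of_real y) \<le> e / 2 * Im (\<i> * of_real y)"
        by blast
      then have "norm (recip_cauchy \<mu> (\<i> * of_real y) - \<i> * of_real y) / y \<le> e / 2"
        using y by (simp add: pos_divide_le_eq)
      moreover have "norm (recip_cauchy \<mu> (\<i> * of_real y) - \<i> * of_real y) / y \<ge> 0"
        using y by simp
      ultimately show ?case using e by (simp only: dist_real_def diff_0_right abs_of_nonneg)
    qed
  qed
qed

lemma recip_cauchy_inj_on:
  assumes "real_distribution \<mu>"
  shows "inj_on (recip_cauchy \<mu>) {w. 0 < Im w \<and> Im (recip_cauchy \<mu> w - w) < Im w}"
  using inj_on_perturbed_identity[OF recip_cauchy_minus_id(1,2)[OF assms], of 1] by simp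

lemma open_inj_region:
  assumes "real_distribution \<mu>"
  shows "open {w. 0 < Im w \<and> Im (recip_cauchy \<mu> w - w) < Im w}"
proof -
  have "continuous_on upper_half_plane (\<lambda>w. Im w - Im (recip_cauchy \<mu> w - w))"
    by (intro continuous_intros holomorphic_on_imp_continuous_on
        real_distribution.holomorphic_recip_cauchy[OF assms])
  from continuous_open_preimage[OF this open_upper_half_plane, of "{0<..}"]
  show ?thesis by (simp add: vimage_def Int_def)
qed

lemma norm_le_on_cone:
  assumes "z \<in> truncated_cone \<alpha> \<beta>"
  shows "norm z \<le> (1 + \<alpha>) * Im z"
  using cmod_le[of z] assms by (simp add: truncated_cone_def algebra_simps)

text \<open>Moving by at most half the height changes heights by at most a factor 2, so |Re w| <
  (\<alpha> + 1) Im z \<le> 2 (\<alpha> + 1) Im w. This is the source of the enlarged aperture in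
  the arguments below.\<close>

lemma truncated_cone_nearby:
  assumes "z \<in> truncated_cone \<alpha> \<beta>" "norm (w - z) \<le> 1 / 2 * Im z"
  shows "w \<in> truncated_cone (2 * \<alpha> + 2) (\<beta> / 2)" and "Im z / 2 \<le> Im w" and "Im w \<le> 2 * Im z"
proof -
  have z: "Im z > 0" "\<bar>Re z\<bar> < \<alpha> * Im z" "Im z > \<beta>"
    using assms(1) by (auto simp: truncated_cone_def)
  have "\<bar>Re w - Re z\<bar> \<le> 1 / 2 * Im z" "\<bar>Im w - Im z\<bar> \<le> 1 / 2 * Im z"
    using abs_Re_le_cmod[of "w - z"] abs_Im_le_cmod[of "w - z"] assms(2) by auto
  then have w: "Im z / 2 \<le> Im w" "Im w \<le> 2 * Im z" "\<bar>Re w\<bar> \<le> \<bar>Re z\<bar> + 1 / 2 * Im z"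
    using z(1) by linarith+
  then show "Im z / 2 \<le> Im w" "Im w \<le> 2 * Im z" by blast+
  have "0 < \<alpha> * Im z" using z(2) by linarith
  then have "\<alpha> > 0" using z(1) by (simp add: zero_less_mult_iff)
  have "\<bar>Re w\<bar> < (\<alpha> + 1) * Im z" using w(3) z by (simp add: algebra_simps)
  also have "\<dots> \<le> (\<alpha> + 1) * (2 * Im w)" using w(1) \<open>\<alpha> > 0\<close> by (intro mult_left_mono) auto
  also have "\<dots> = (2 * \<alpha> + 2) * Im w" by (simp add: algebra_simps)
  finally have "\<bar>Re w\<bar> < (2 * \<alpha> + 2) * Im w" .
  moreover have "Im w > 0" "Im w > \<beta> / 2" using w(1) z by linarith+
  ultimately show "w \<in> truncated_cone (2 * \<alpha> + 2) (\<beta> / 2)"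
    by (simp add: truncated_cone_def)
qed

lemma holomorphic_inverse_exists:
  assumes "f holomorphic_on S" "open S" "inj_on f S"
  shows "\<exists>g. g holomorphic_on (f ` S) \<and> (\<forall>w\<in>S. g (f w) = w)"
  using holomorphic_has_inverse[OF assms] by metis

text \<open>Solving F(w) = z means finding a fixed point of w \<mapsto> z - K(w), which Brouwer
  provides on a small disc around z. The solutions lie in the region where F is injective, so the
  holomorphic inverse on the image of that region selects them all at once.\<close>

lemma recip_cauchy_inverse_exists:
  assumes \<mu>: "real_distribution \<mu>" and \<alpha>: "\<alpha> > 0" and \<epsilon>: "0 < \<epsilon>" "\<epsilon> \<le> 1 / 2"
  obtains \<beta> g where "\<beta> > 0" and "is_recip_cauchy_inverse \<mu> \<alpha> \<beta> g"
    and "\<And>z. z \<in> truncated_cone \<alpha> \<beta> \<Longrightarrow> norm (g z - z) \<le> \<epsilon> * Im z"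
proof -
  interpret real_distribution \<mu> by fact
  define K where "K w = recip_cauchy \<mu> w - w" for w
  let ?C = "truncated_cone (2 * \<alpha> + 2)"
  let ?S = "{w. 0 < Im w \<and> Im (recip_cauchy \<mu> w - w) < Im w}"
  obtain \<beta>' where \<beta>': "\<beta>' > 0" "\<forall>w\<in>?C \<beta>'. norm (K w) \<le> \<epsilon> / 2 * Im w"
    using recip_cauchy_close_on_cone[of "2 * \<alpha> + 2" "\<epsilon> / 2"] \<alpha> \<epsilon> by (auto simp: K_def)
  \<comment> \<open>Points of the disc around z may lie at half the height of z, yet must stay above
    \<beta>'.\<close>
  define \<beta> where "\<beta> = 2 * \<beta>'"
  have \<beta>0: "\<beta> > 0" using \<beta>' by (simp add: \<beta>_def)
  have solve: "\<exists>w\<in>?S. norm (w - z) \<le> \<epsilon> * Im z \<and> recip_cauchy \<mu> w = z"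
    if z: "z \<in> truncated_cone \<alpha> \<beta>" for z
  proof -
    have Imz: "Im z > 0" using z by (simp add: truncated_cone_def)
    let ?B = "cball z (\<epsilon> * Im z)"
    have near: "norm (w - z) \<le> 1 / 2 * Im z" if "w \<in> ?B" for w
    proof -
      have "norm (w - z) \<le> \<epsilon> * Im z" using that by (simp add: dist_norm norm_minus_commute)
      also have "\<dots> \<le> 1 / 2 * Im z" using \<epsilon> Imz by (intro mult_right_mono) auto
      finally show ?thesis .
    qed
    have inC: "w \<in> ?C \<beta>'" if "w \<in> ?B" for w
      using truncated_cone_nearby(1)[OF z near[OF that]] by (simp add: \<beta>_def)
    have sub: "?B \<subseteq> upper_half_plane"
      using inC by (auto simp: truncated_cone_def simp del: mem_upper_half_plane mem_cball)
    have "continuous_on ?B (\<lambda>w. z - K w)"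
      unfolding K_def
      by (intro continuous_intros continuous_on_subset[OF holomorphic_on_imp_continuous_on
            [OF holomorphic_recip_cauchy] sub])
    moreover have "(\<lambda>w. z - K w) \<in> ?B \<rightarrow> ?B"
    proof
      fix w assume w: "w \<in> ?B"
      have "norm (K w) \<le> \<epsilon> / 2 * Im w" using \<beta>'(2) inC[OF w] by blast
      also have "\<dots> \<le> \<epsilon> / 2 * (2 * Im z)"
        using truncated_cone_nearby(3)[OF z near[OF w]] \<epsilon> by (intro mult_left_mono) auto
      finally show "z - K w \<in> ?B" by (simp add: dist_norm)
    qed
    moreover have "0 \<le> \<epsilon> * Im z" using Imz \<epsilon> by simp
    then have "?B \<noteq> {}" by (simp only: cball_eq_empty not_less)
    ultimately obtain w where w: "w \<in> ?B" "z - K w = w"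
      using brouwer[OF compact_cball convex_cball] by metis
    have Imw: "Im w > 0" using inC[OF w(1)] by (simp add: truncated_cone_def)
    have "Im (K w) \<le> norm (K w)" using abs_Im_le_cmod[of "K w"] by linarith
    also have "\<dots> \<le> \<epsilon> / 2 * Im w" using \<beta>'(2) inC[OF w(1)] by blast
    also have "\<dots> < 1 * Im w" using \<epsilon> Imw by (intro mult_strict_right_mono) auto
    finally have "w \<in> ?S" using Imw by (simp add: K_def)
    moreover have "recip_cauchy \<mu> w = z" using w(2) by (simp add: K_def algebra_simps)
    moreover have "norm (w - z) \<le> \<epsilon> * Im z" using w(1) by (simp add: dist_norm norm_minus_commute)
    ultimately show ?thesis by blast
  qed
  have "recip_cauchy \<mu> holomorphic_on ?S"
    by (rule holomorphic_on_subset[OF holomorphic_recip_cauchy]) auto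
  from holomorphic_inverse_exists[OF this open_inj_region[OF \<mu>] recip_cauchy_inj_on[OF \<mu>]]
  obtain g where g: "g holomorphic_on (recip_cauchy \<mu> ` ?S)" "\<forall>w\<in>?S. g (recip_cauchy \<mu> w) = w"
    by (elim exE conjE)
  have gz: "g z \<in> ?S" "recip_cauchy \<mu> (g z) = z" "norm (g z - z) \<le> \<epsilon> * Im z" "z \<in> recip_cauchy \<mu> ` ?S"
    if z: "z \<in> truncated_cone \<alpha> \<beta>" for z
  proof -
    obtain w where w: "w \<in> ?S" "norm (w - z) \<le> \<epsilon> * Im z" "recip_cauchy \<mu> w = z"
      using solve[OF z] by blast
    have "g z = w" using g(2)[rule_format, OF w(1)] w(3) by simp
    then show "g z \<in> ?S" "recip_cauchy \<mu> (g z) = z" "norm (g z - z) \<le> \<epsilon> * Im z"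
      using w by simp_all
    show "z \<in> recip_cauchy \<mu> ` ?S" using w by blast
  qed
  have "((\<lambda>z. g z / z) \<longlongrightarrow> 1) (inf at_infinity (principal (truncated_cone \<alpha> \<beta>)))"
  proof (rule tendstoI)
    fix e :: real assume e: "e > 0"
    obtain b where b: "b > 0" "\<forall>w\<in>?C b. norm (K w) \<le> e / 4 * Im w"
      using recip_cauchy_close_on_cone[of "2 * \<alpha> + 2" "e / 4"] \<alpha> e by (auto simp: K_def)
    show "\<forall>\<^sub>F z in inf at_infinity (principal (truncated_cone \<alpha> \<beta>)). dist (g z / z) 1 < e"
      unfolding eventually_inf_principal eventually_at_infinity
    \<comment> \<open>On the cone |z| \<le> (1 + \<alpha>) Im z, so this radius forces Im z \<ge> 2
      b + 1 and g(z) remains above height b.\<close>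
    proof (intro exI[of _ "(1 + \<alpha>) * (2 * b + 1)"] allI impI)
      fix z assume n: "(1 + \<alpha>) * (2 * b + 1) \<le> norm z" and z: "z \<in> truncated_cone \<alpha> \<beta>"
      have Imz: "Im z > 0" using z by (simp add: truncated_cone_def)
      have "(1 + \<alpha>) * (2 * b + 1) \<le> (1 + \<alpha>) * Im z" using n norm_le_on_cone[OF z] by linarith
      then have "2 * b + 1 \<le> Im z" using \<alpha> by (simp add: mult_le_cancel_left_pos)
      then have z2: "z \<in> truncated_cone \<alpha> (2 * b)" using z by (simp add: truncated_cone_def)
      have near: "norm (g z - z) \<le> 1 / 2 * Im z"
        using gz(3)[OF z] mult_right_mono[of \<epsilon> "1 / 2" "Im z"] \<epsilon> Imz by linarith
      have "g z \<in> ?C b" using truncated_cone_nearby(1)[OF z2 near] by simp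
      then have "norm (K (g z)) \<le> e / 4 * Im (g z)" using b(2) by blast
      also have "\<dots> \<le> e / 4 * (2 * Im z)"
        using truncated_cone_nearby(3)[OF z near] e by (intro mult_left_mono) auto
      also have "\<dots> \<le> e / 2 * norm z" using abs_Im_le_cmod[of z] e by simp
      also have "K (g z) = z - g z" using gz(2)[OF z] by (simp add: K_def)
      finally have "norm (z - g z) \<le> e / 2 * norm z" .
      moreover have z0: "norm z > 0" using Imz by auto
      ultimately have "norm (z - g z) / norm z \<le> e / 2" by (simp add: pos_divide_le_eq)
      moreover have "dist (g z / z) 1 = norm (z - g z) / norm z"
      proof -
        have "g z / z - 1 = (g z - z) / z" using z0 by (simp add: diff_divide_distrib)
        then show ?thesis by (simp add: dist_norm norm_divide norm_minus_commute)
      qed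
      ultimately show "dist (g z / z) 1 < e" using e by linarith
    qed
  qed
  then have "is_recip_cauchy_inverse \<mu> \<alpha> \<beta> g"
    unfolding is_recip_cauchy_inverse_def
  proof (intro conjI ballI)
    show "g holomorphic_on truncated_cone \<alpha> \<beta>"
      by (rule holomorphic_on_subset[OF g(1)]) (rule subsetI, rule gz(4))
    show "g z \<in> upper_half_plane" if "z \<in> truncated_cone \<alpha> \<beta>" for z
      using gz(1)[OF that] by simp
    show "recip_cauchy \<mu> (g z) = z" if "z \<in> truncated_cone \<alpha> \<beta>" for z
      by (rule gz(2)[OF that])
  qed
  from that[OF \<beta>0 this gz(3)] show thesis .
qed

text \<open>The normalisation g(z) / z \<rightarrow> 1 is what singles out one branch: closeness 1 /
  (2 (1 + \<alpha>)) of the quotient becomes |g(z) - z| \<le> Im z / 2 on the cone, and at such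
  points K is small compared with the height.\<close>

lemma recip_cauchy_inverse_in_inj_region:
  assumes \<mu>: "real_distribution \<mu>" and \<alpha>: "\<alpha> > 0" and g: "is_recip_cauchy_inverse \<mu> \<alpha> \<beta> g"
  shows "\<exists>R. \<forall>z\<in>truncated_cone \<alpha> \<beta>. Im z \<ge> R \<longrightarrow> 0 < Im (g z) \<and> Im (recip_cauchy \<mu> (g z) - g z) < Im (g z)"
proof -
  interpret real_distribution \<mu> by fact
  have "((\<lambda>z. g z / z) \<longlongrightarrow> 1) (inf at_infinity (principal (truncated_cone \<alpha> \<beta>)))"
    using g by (simp add: is_recip_cauchy_inverse_def)
  moreover have e: "1 / (2 * (1 + \<alpha>)) > 0" using \<alpha> by simp
  ultimately have "\<forall>\<^sub>F z in inf at_infinity (principal (truncated_cone \<alpha> \<beta>)). dist (g z / z) 1 < 1 / (2 * (1 + \<alpha>))"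
    by (rule tendstoD)
  then obtain r where r: "\<And>z. norm z \<ge> r \<Longrightarrow> z \<in> truncated_cone \<alpha> \<beta> \<Longrightarrow> dist (g z / z) 1 < 1 / (2 * (1 + \<alpha>))"
    unfolding eventually_inf_principal eventually_at_infinity by blast
  obtain b where b: "b > 0" "\<forall>w\<in>truncated_cone (2 * \<alpha> + 2) b. norm (recip_cauchy \<mu> w - w) \<le> 1 / 2 * Im w"
    using recip_cauchy_close_on_cone[of "2 * \<alpha> + 2" "1 / 2"] \<alpha> by auto
  show ?thesis
  proof (intro exI[of _ "max r (2 * b + 1)"] ballI impI)
    fix z assume z: "z \<in> truncated_cone \<alpha> \<beta>" and R: "max r (2 * b + 1) \<le> Im z"
    have Imz: "Im z > 0" using z by (simp add: truncated_cone_def)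
    have "norm z \<ge> r" using R abs_Im_le_cmod[of z] by linarith
    from r[OF this z] have d: "dist (g z / z) 1 < 1 / (2 * (1 + \<alpha>))" .
    have z0: "norm z > 0" using Imz by auto
    have "g z - z = (g z / z - 1) * z" using z0 by (simp add: left_diff_distrib)
    then have "norm (g z - z) = dist (g z / z) 1 * norm z"
      by (simp only: dist_norm norm_mult)
    also have "\<dots> \<le> 1 / (2 * (1 + \<alpha>)) * ((1 + \<alpha>) * Im z)"
      using d norm_le_on_cone[OF z] e by (intro mult_mono) auto
    also have "\<dots> = 1 / 2 * Im z"
    proof -
      have "1 / (2 * a) * (a * x) = 1 / 2 * x" if "a > 0" for a x :: real using that by simp
      then show ?thesis using \<alpha> by (simp only: add_pos_pos zero_less_one)
    qed
    finally have near: "norm (g z - z) \<le> 1 / 2 * Im z" .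
    have "z \<in> truncated_cone \<alpha> (2 * b)" using z R by (simp add: truncated_cone_def)
    from truncated_cone_nearby(1)[OF this near] have "g z \<in> truncated_cone (2 * \<alpha> + 2) b" by simp
    then have "norm (recip_cauchy \<mu> (g z) - g z) \<le> 1 / 2 * Im (g z)" "Im (g z) > 0"
      using b(2) by (auto simp: truncated_cone_def)
    then show "0 < Im (g z) \<and> Im (recip_cauchy \<mu> (g z) - g z) < Im (g z)"
      using abs_Im_le_cmod[of "recip_cauchy \<mu> (g z) - g z"] by linarith
  qed
qed

text \<open>Far out both inverses take values in one region of injectivity of F. The cones may
  differ, because two candidates for a free power may come with different cones and different right
  inverses.\<close>

lemma recip_cauchy_inverse_unique:
  assumes \<mu>: "real_distribution \<mu>" and "\<alpha>1 > 0" "\<alpha>2 > 0"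
    and g1: "is_recip_cauchy_inverse \<mu> \<alpha>1 \<beta>1 g1" and g2: "is_recip_cauchy_inverse \<mu> \<alpha>2 \<beta>2 g2"
  shows "\<exists>R. \<forall>z\<in>truncated_cone \<alpha>1 \<beta>1 \<inter> truncated_cone \<alpha>2 \<beta>2. Im z \<ge> R \<longrightarrow> g1 z = g2 z"
proof -
  obtain R1 where R1: "\<forall>z\<in>truncated_cone \<alpha>1 \<beta>1. Im z \<ge> R1 \<longrightarrow>
      0 < Im (g1 z) \<and> Im (recip_cauchy \<mu> (g1 z) - g1 z) < Im (g1 z)"
    using recip_cauchy_inverse_in_inj_region[OF \<mu> \<open>\<alpha>1 > 0\<close> g1] by blast
  obtain R2 where R2: "\<forall>z\<in>truncated_cone \<alpha>2 \<beta>2. Im z \<ge> R2 \<longrightarrow>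
      0 < Im (g2 z) \<and> Im (recip_cauchy \<mu> (g2 z) - g2 z) < Im (g2 z)"
    using recip_cauchy_inverse_in_inj_region[OF \<mu> \<open>\<alpha>2 > 0\<close> g2] by blast
  show ?thesis
  proof (intro exI[of _ "max R1 R2"] ballI impI)
    fix z assume z: "z \<in> truncated_cone \<alpha>1 \<beta>1 \<inter> truncated_cone \<alpha>2 \<beta>2" and R: "max R1 R2 \<le> Im z"
    have "recip_cauchy \<mu> (g1 z) = recip_cauchy \<mu> (g2 z)"
      using z g1 g2 by (simp add: is_recip_cauchy_inverse_def)
    then show "g1 z = g2 z"
    proof (rule inj_onD[OF recip_cauchy_inj_on[OF \<mu>]])
      show "g1 z \<in> {w. 0 < Im w \<and> Im (recip_cauchy \<mu> w - w) < Im w}"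
        using R1[rule_format, of z] z R by simp
      show "g2 z \<in> {w. 0 < Im w \<and> Im (recip_cauchy \<mu> w - w) < Im w}"
        using R2[rule_format, of z] z R by simp
    qed
  qed
qed

subsection \<open>Free and Boolean powers\<close>

text \<open>
  The predicate under the definite description in \<^const>\<open>free_power\<close>.
\<close>

definition is_free_power :: "real measure \<Rightarrow> real \<Rightarrow> real measure \<Rightarrow> bool" where
  "is_free_power \<mu> t \<nu> \<longleftrightarrow> real_distribution \<nu> \<and>
     (\<exists>\<alpha>>0. \<exists>\<beta>>0. \<exists>V W. is_V_transform \<mu> \<alpha> \<beta> V \<and> is_V_transform \<nu> \<alpha> \<beta> W \<and>
        (\<forall>z\<in>truncated_cone \<alpha> \<beta>. W z = of_real t * V z))"

lemma is_free_powerE: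
  assumes "is_free_power \<mu> t \<nu>"
  obtains \<alpha> \<beta> g h where "\<alpha> > 0" "\<beta> > 0" "is_recip_cauchy_inverse \<mu> \<alpha> \<beta> g"
    "is_recip_cauchy_inverse \<nu> \<alpha> \<beta> h"
    "\<And>z. z \<in> truncated_cone \<alpha> \<beta> \<Longrightarrow> h z = z + of_real t * (g z - z)"
proof -
  obtain \<alpha> \<beta> V W where *: "\<alpha> > 0" "\<beta> > 0" "is_V_transform \<mu> \<alpha> \<beta> V" "is_V_transform \<nu> \<alpha> \<beta> W"
    "\<forall>z\<in>truncated_cone \<alpha> \<beta>. W z = of_real t * V z"
    using assms unfolding is_free_power_def by blast
  obtain g where g: "is_recip_cauchy_inverse \<mu> \<alpha> \<beta> g" "\<forall>z\<in>truncated_cone \<alpha> \<beta>. V z = g z - z"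
    using *(3) unfolding is_V_transform_def by blast
  obtain h where h: "is_recip_cauchy_inverse \<nu> \<alpha> \<beta> h" "\<forall>z\<in>truncated_cone \<alpha> \<beta>. W z = h z - z"
    using *(4) unfolding is_V_transform_def by blast
  have "h z = z + of_real t * (g z - z)" if "z \<in> truncated_cone \<alpha> \<beta>" for z
  proof -
    have "h z = z + W z" using h(2) that by simp
    then show ?thesis using *(5) g(2) that by simp
  qed
  then show thesis using that[OF *(1,2) g(1) h(1)] by blast
qed

text \<open>On a common cone D the inverses for \<mu> agree, hence so do those for the candidates.
  The two reciprocal transforms then coincide on the image of D, which is open because the inverse
  is injective, and analytic continuation with Stieltjes inversion finishes.\<close>

lemma is_free_power_unique:
  assumes \<mu>: "real_distribution \<mu>" and "is_free_power \<mu> t \<nu>1" "is_free_power \<mu> t \<nu>2"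
  shows "\<nu>1 = \<nu>2"
proof -
  have \<nu>: "real_distribution \<nu>1" "real_distribution \<nu>2"
    using assms by (simp_all add: is_free_power_def)
  interpret \<nu>1: real_distribution \<nu>1 by (rule \<nu>)
  interpret \<nu>2: real_distribution \<nu>2 by (rule \<nu>)
  obtain \<alpha>1 \<beta>1 g1 h1 where 1: "\<alpha>1 > 0" "\<beta>1 > 0" "is_recip_cauchy_inverse \<mu> \<alpha>1 \<beta>1 g1"
    "is_recip_cauchy_inverse \<nu>1 \<alpha>1 \<beta>1 h1"
    "\<And>z. z \<in> truncated_cone \<alpha>1 \<beta>1 \<Longrightarrow> h1 z = z + of_real t * (g1 z - z)"
    using is_free_powerE[OF assms(2)] by blast
  obtain \<alpha>2 \<beta>2 g2 h2 where 2: "\<alpha>2 > 0" "\<beta>2 > 0" "is_recip_cauchy_inverse \<mu> \<alpha>2 \<beta>2 g2"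
    "is_recip_cauchy_inverse \<nu>2 \<alpha>2 \<beta>2 h2"
    "\<And>z. z \<in> truncated_cone \<alpha>2 \<beta>2 \<Longrightarrow> h2 z = z + of_real t * (g2 z - z)"
    using is_free_powerE[OF assms(3)] by blast
  obtain R where R: "\<forall>z\<in>truncated_cone \<alpha>1 \<beta>1 \<inter> truncated_cone \<alpha>2 \<beta>2. Im z \<ge> R \<longrightarrow> g1 z = g2 z"
    using recip_cauchy_inverse_unique[OF \<mu> 1(1) 2(1) 1(3) 2(3)] by blast
  define \<alpha> where "\<alpha> = min \<alpha>1 \<alpha>2"
  define D where "D = truncated_cone \<alpha> (max R (max \<beta>1 \<beta>2))"
  have \<alpha>: "\<alpha> > 0" using 1(1) 2(1) by (simp add: \<alpha>_def)
  have D_eq: "D = {z. 0 < Im z} \<inter> {z. \<bar>Re z\<bar> < \<alpha> * Im z} \<inter> {z. max R (max \<beta>1 \<beta>2) < Im z}"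
    by (auto simp: D_def truncated_cone_def)
  have inD: "z \<in> truncated_cone \<alpha>1 \<beta>1" "z \<in> truncated_cone \<alpha>2 \<beta>2" "R \<le> Im z" if "z \<in> D" for z
  proof -
    have z: "0 < Im z" "\<bar>Re z\<bar> < \<alpha> * Im z" "max R (max \<beta>1 \<beta>2) < Im z"
      using that by (auto simp: D_eq)
    moreover have "\<alpha> * Im z \<le> \<alpha>1 * Im z" "\<alpha> * Im z \<le> \<alpha>2 * Im z"
      using z(1) by (auto simp: \<alpha>_def intro!: mult_right_mono)
    ultimately have "\<bar>Re z\<bar> < \<alpha>1 * Im z" "\<bar>Re z\<bar> < \<alpha>2 * Im z" by linarith+
    with z show "z \<in> truncated_cone \<alpha>1 \<beta>1" "z \<in> truncated_cone \<alpha>2 \<beta>2" "R \<le> Im z"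
      by (auto simp: truncated_cone_def)
  qed
  have h1: "h1 z \<in> upper_half_plane" "recip_cauchy \<nu>1 (h1 z) = z" if "z \<in> D" for z
    using 1(4) inD(1)[OF that] unfolding is_recip_cauchy_inverse_def by blast+
  have h2: "recip_cauchy \<nu>2 (h2 z) = z" if "z \<in> D" for z
    using 2(4) inD(2)[OF that] unfolding is_recip_cauchy_inverse_def by blast
  have h12: "h1 z = h2 z" if "z \<in> D" for z
  proof -
    have "g1 z = g2 z" using R inD[OF that] by blast
    then show ?thesis using 1(5)[OF inD(1)[OF that]] 2(5)[OF inD(2)[OF that]] by simp
  qed
  have openD: "open D"
    unfolding D_eq by (intro open_Int open_Collect_less continuous_intros)
  have "\<i> * of_real m \<in> D" if "m > max R (max \<beta>1 \<beta>2)" for m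
    using \<alpha> 1(2) that by (simp add: D_eq)
  from this[OF less_add_one] have neD: "D \<noteq> {}" by blast
  have "h1 holomorphic_on truncated_cone \<alpha>1 \<beta>1"
    using 1(4) by (simp add: is_recip_cauchy_inverse_def)
  then have hol: "h1 holomorphic_on D"
    by (rule holomorphic_on_subset) (use inD(1) in blast)
  have "inj_on h1 D"
    by (rule inj_on_inverseI[of _ "recip_cauchy \<nu>1"]) (rule h1(2))
  then have op: "open (h1 ` D)"
    by (rule open_mapping_thm3[OF hol openD])
  have "recip_cauchy \<nu>1 z = recip_cauchy \<nu>2 z" if "Im z > 0" for z
  proof (rule analytic_continuation_open[of "h1 ` D" upper_half_plane "recip_cauchy \<nu>1" "recip_cauchy \<nu>2"])
    show "h1 ` D \<subseteq> upper_half_plane" using h1(1) by blast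
    show "recip_cauchy \<nu>1 w = recip_cauchy \<nu>2 w" if w: "w \<in> h1 ` D" for w
    proof -
      obtain z where z: "z \<in> D" "w = h1 z" using w by blast
      then show ?thesis using h1(2)[OF z(1)] h2[OF z(1)] h12[OF z(1)] by simp
    qed
    show "h1 ` D \<noteq> {}" using neD by simp
    show "z \<in> upper_half_plane" using that by simp
  qed (rule op open_upper_half_plane connected_upper_half_plane
      \<nu>1.holomorphic_recip_cauchy \<nu>2.holomorphic_recip_cauchy)+
  then show ?thesis by (rule recip_cauchy_unique[OF \<nu>])
qed

text \<open>At w = g(z), with g an inverse of F on a cone, the argument t w + (1 - t) F(w) equals z
  + t (g(z) - z). The hypothesis thus states that this function is a right inverse for
  \<nu>.\<close>

lemma free_power_eqI:
  assumes \<mu>: "real_distribution \<mu>" and \<nu>: "real_distribution \<nu>" and t: "t \<ge> 1"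
    and eq: "\<And>w. Im w > 0 \<Longrightarrow> Im (of_real t * w + (1 - of_real t) * recip_cauchy \<mu> w) > 0 \<Longrightarrow>
      recip_cauchy \<nu> (of_real t * w + (1 - of_real t) * recip_cauchy \<mu> w) = recip_cauchy \<mu> w"
  shows "free_power \<mu> t = \<nu>"
proof -
  \<comment> \<open>With this accuracy of g the function h moves z by at most Im z / 2 and stays in
    the upper half-plane.\<close>
  have "1 / (2 * t) > 0" "1 / (2 * t) \<le> 1 / 2" using t by (simp_all add: field_simps)
  then obtain \<beta> g where \<beta>: "\<beta> > 0" and g: "is_recip_cauchy_inverse \<mu> 1 \<beta> g"
    and near: "\<And>z. z \<in> truncated_cone 1 \<beta> \<Longrightarrow> norm (g z - z) \<le> 1 / (2 * t) * Im z"
    using recip_cauchy_inverse_exists[OF \<mu> zero_less_one, of "1 / (2 * t)"] by metis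
  define h where "h z = z + of_real t * (g z - z)" for z
  have gC: "Im (g z) > 0" "recip_cauchy \<mu> (g z) = z" if "z \<in> truncated_cone 1 \<beta>" for z
    using g that by (auto simp: is_recip_cauchy_inverse_def)
  have hpos: "Im (h z) > 0" if z: "z \<in> truncated_cone 1 \<beta>" for z
  proof -
    have Imz: "Im z > 0" using z by (simp add: truncated_cone_def)
    have "norm (h z - z) = t * norm (g z - z)" using t by (simp add: h_def norm_mult)
    also have "\<dots> \<le> t * (1 / (2 * t) * Im z)" using near[OF z] t by (intro mult_left_mono) auto
    also have "\<dots> = Im z / 2" using t by simp
    finally have "norm (h z - z) \<le> Im z / 2" .
    moreover have "\<bar>Im (h z) - Im z\<bar> \<le> norm (h z - z)" using abs_Im_le_cmod[of "h z - z"] by simp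
    ultimately show ?thesis using Imz by linarith
  qed
  have h_eq: "h z = of_real t * g z + (1 - of_real t) * recip_cauchy \<mu> (g z)"
    if "z \<in> truncated_cone 1 \<beta>" for z
    by (simp add: h_def gC(2)[OF that] algebra_simps)
  have h: "is_recip_cauchy_inverse \<nu> 1 \<beta> h"
    unfolding is_recip_cauchy_inverse_def
  proof (intro conjI ballI)
    show "h holomorphic_on truncated_cone 1 \<beta>"
      unfolding h_def using g by (intro holomorphic_intros) (simp add: is_recip_cauchy_inverse_def)
    show "h z \<in> upper_half_plane" if "z \<in> truncated_cone 1 \<beta>" for z
      using hpos[OF that] by simp
    show "recip_cauchy \<nu> (h z) = z" if z: "z \<in> truncated_cone 1 \<beta>" for z
      using eq[OF gC(1)[OF z]] hpos[OF z] gC(2)[OF z] unfolding h_eq[OF z] by simp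
    have "((\<lambda>z. g z / z) \<longlongrightarrow> 1) (inf at_infinity (principal (truncated_cone 1 \<beta>)))"
      using g by (simp add: is_recip_cauchy_inverse_def)
    then have "((\<lambda>z. 1 + of_real t * (g z / z - 1)) \<longlongrightarrow> 1 + of_real t * (1 - 1))
        (inf at_infinity (principal (truncated_cone 1 \<beta>)))"
      by (intro tendsto_intros)
    moreover have "\<forall>\<^sub>F z in inf at_infinity (principal (truncated_cone 1 \<beta>)).
        1 + of_real t * (g z / z - 1) = h z / z"
      unfolding eventually_inf_principal
    proof (intro always_eventually allI impI)
      fix z assume "z \<in> truncated_cone 1 \<beta>"
      then have "z \<noteq> 0" by (auto simp: truncated_cone_def)
      then have "1 + of_real t * (g z / z - 1) = (z + of_real t * (g z - z)) / z"
        by (simp add: field_simps)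
      then show "1 + of_real t * (g z / z - 1) = h z / z" by (simp add: h_def)
    qed
    ultimately have "((\<lambda>z. h z / z) \<longlongrightarrow> 1 + of_real t * (1 - 1))
        (inf at_infinity (principal (truncated_cone 1 \<beta>)))"
      by (rule Lim_transform_eventually)
    then show "((\<lambda>z. h z / z) \<longlongrightarrow> 1) (inf at_infinity (principal (truncated_cone 1 \<beta>)))"
      by simp
  qed
  have "is_V_transform \<mu> 1 \<beta> (\<lambda>z. g z - z)" "is_V_transform \<nu> 1 \<beta> (\<lambda>z. h z - z)"
    using g h by (auto simp: is_V_transform_def)
  moreover have "\<forall>z\<in>truncated_cone 1 \<beta>. h z - z = of_real t * (g z - z)" by (simp add: h_def)
  ultimately have "is_free_power \<mu> t \<nu>"
    unfolding is_free_power_def using \<nu> \<beta> zero_less_one by blast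
  then have "(THE \<nu>. is_free_power \<mu> t \<nu>) = \<nu>"
    by (rule the_equality) (rule is_free_power_unique[OF \<mu> _ \<open>is_free_power \<mu> t \<nu>\<close>])
  then show ?thesis by (simp only: free_power_def is_free_power_def)
qed

text \<open>The candidate has reciprocal transform F composed with \<omega>, where \<omega> is the
  global right inverse of w - (t - 1) K(w), the subordination function of the free power.\<close>

lemma free_power_subordination:
  assumes \<mu>: "real_distribution \<mu>" and t: "t \<ge> 1"
  shows "real_distribution (free_power \<mu> t)"
    and "\<And>w. Im w > 0 \<Longrightarrow> Im (of_real t * w + (1 - of_real t) * recip_cauchy \<mu> w) > 0 \<Longrightarrow>
      recip_cauchy (free_power \<mu> t) (of_real t * w + (1 - of_real t) * recip_cauchy \<mu> w) = recip_cauchy \<mu> w"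
proof -
  interpret real_distribution \<mu> by fact
  define K where "K w = recip_cauchy \<mu> w - w" for w
  define c where "c = t - 1"
  note K = recip_cauchy_minus_id[OF \<mu>, folded K_def]
  have c: "c \<ge> 0" using t by (simp add: c_def)
  have H: "w - of_real c * K w = of_real t * w + (1 - of_real t) * recip_cauchy \<mu> w" for w
    by (simp add: c_def K_def algebra_simps)
  obtain \<omega> where \<omega>: "\<omega> holomorphic_on upper_half_plane"
    "\<And>z. Im z > 0 \<Longrightarrow> Im z \<le> Im (\<omega> z)"
    "\<And>z. Im z > 0 \<Longrightarrow> \<omega> z - of_real c * K (\<omega> z) = z"
    "\<And>w. Im w > 0 \<Longrightarrow> Im (w - of_real c * K w) > 0 \<Longrightarrow> \<omega> (w - of_real c * K w) = w"
    "((\<lambda>y. norm (\<omega> (\<i> * of_real y) - \<i> * of_real y) / y) \<longlongrightarrow> 0) at_top"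
    using perturbed_identity_global_inverse[OF K c] by blast
  define F where "F z = recip_cauchy \<mu> (\<omega> z)" for z
  have \<omega>pos: "Im (\<omega> z) > 0" if "Im z > 0" for z
    using \<omega>(2)[OF that] that by linarith
  have "(recip_cauchy \<mu> \<circ> \<omega>) holomorphic_on upper_half_plane"
    by (rule holomorphic_on_compose_gen[OF \<omega>(1) holomorphic_recip_cauchy]) (use \<omega>pos in auto)
  then have holF: "F holomorphic_on upper_half_plane" by (simp add: F_def [abs_def] o_def)
  have geF: "Im z \<le> Im (F z)" if "Im z > 0" for z
    using \<omega>(2)[OF that] Im_recip_cauchy_ge[OF \<omega>pos[OF that]] by (simp add: F_def)
  \<comment> \<open>The composite is F(\<omega>(z)) and the cone estimate does not control where
    \<omega>(iy) lies. Instead, \<omega>(z) - z = c K(\<omega>(z)) makes the displacement of the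
    composite equal to t K(\<omega>(z)), that is t / c times that of \<omega>. For c = 0 the map
    \<omega> is the identity.\<close>
  have limF: "((\<lambda>y. norm (F (\<i> * of_real y) - \<i> * of_real y) / y) \<longlongrightarrow> 0) at_top"
  proof (cases "c = 0")
    case True
    have "\<forall>\<^sub>F y in at_top. norm (K (\<i> * of_real y)) / y = norm (F (\<i> * of_real y) - \<i> * of_real y) / y"
      using eventually_gt_at_top[of 0]
    proof eventually_elim
      case (elim y)
      then have "\<omega> (\<i> * of_real y) = \<i> * of_real y" using \<omega>(3)[of "\<i> * of_real y"] True by simp
      then show ?case by (simp add: F_def K_def)
    qed
    then show ?thesis by (rule Lim_transform_eventually[OF K(3)])
  next
    case False
    have "((\<lambda>y. (t / c) * (norm (\<omega> (\<i> * of_real y) - \<i> * of_real y) / y)) \<longlongrightarrow> (t / c) * 0) at_top"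
      by (intro tendsto_intros \<omega>(5))
    moreover have "\<forall>\<^sub>F y in at_top. (t / c) * (norm (\<omega> (\<i> * of_real y) - \<i> * of_real y) / y)
        = norm (F (\<i> * of_real y) - \<i> * of_real y) / y"
      using eventually_gt_at_top[of 0]
    proof eventually_elim
      case (elim y)
      let ?z = "\<i> * of_real y"
      have "\<omega> ?z - of_real c * K (\<omega> ?z) = ?z" using elim by (intro \<omega>(3)) simp
      then have e: "\<omega> ?z - ?z = of_real c * K (\<omega> ?z)" by (simp add: algebra_simps)
      have "F ?z - ?z = K (\<omega> ?z) + (\<omega> ?z - ?z)" by (simp add: F_def K_def)
      also have "\<dots> = of_real t * K (\<omega> ?z)" unfolding e by (simp add: c_def algebra_simps)
      finally have "norm (F ?z - ?z) = t * norm (K (\<omega> ?z))" using t by (simp add: norm_mult)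
      moreover have "norm (\<omega> ?z - ?z) = c * norm (K (\<omega> ?z))" unfolding e using c by (simp add: norm_mult)
      ultimately show ?case using False by simp
    qed
    ultimately have "((\<lambda>y. norm (F (\<i> * of_real y) - \<i> * of_real y) / y) \<longlongrightarrow> (t / c) * 0) at_top"
      by (rule Lim_transform_eventually)
    then show ?thesis by simp
  qed
  obtain \<nu> where \<nu>: "real_distribution \<nu>" "\<And>z. Im z > 0 \<Longrightarrow> recip_cauchy \<nu> z = F z"
    using recip_cauchy_exists[OF holF geF limF] by blast
  have sub: "recip_cauchy \<nu> (of_real t * w + (1 - of_real t) * recip_cauchy \<mu> w) = recip_cauchy \<mu> w"
    if "Im w > 0" "Im (of_real t * w + (1 - of_real t) * recip_cauchy \<mu> w) > 0" for w
  proof -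
    have "Im (w - of_real c * K w) > 0" unfolding H by (rule that(2))
    from \<nu>(2)[OF this] have "recip_cauchy \<nu> (w - of_real c * K w) = recip_cauchy \<mu> w"
      unfolding F_def \<omega>(4)[OF that(1) \<open>Im (w - of_real c * K w) > 0\<close>] .
    then show ?thesis unfolding H .
  qed
  have "free_power \<mu> t = \<nu>" by (rule free_power_eqI[OF \<mu> \<nu>(1) t sub])
  then show "real_distribution (free_power \<mu> t)"
    and "\<And>w. Im w > 0 \<Longrightarrow> Im (of_real t * w + (1 - of_real t) * recip_cauchy \<mu> w) > 0 \<Longrightarrow>
      recip_cauchy (free_power \<mu> t) (of_real t * w + (1 - of_real t) * recip_cauchy \<mu> w) = recip_cauchy \<mu> w"
    using \<nu>(1) sub by simp_all
qed

text \<open>A Boolean power multiplies F - id by t > 0, so the lower bound on the imaginary part and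
  the sublinear growth carry over to the new function.\<close>

lemma boolean_power:
  assumes \<mu>: "real_distribution \<mu>" and t: "t > 0"
  shows "real_distribution (boolean_power \<mu> t)"
    and "Im z > 0 \<Longrightarrow> recip_cauchy (boolean_power \<mu> t) z = of_real t * recip_cauchy \<mu> z + (1 - of_real t) * z"
proof -
  interpret real_distribution \<mu> by fact
  let ?P = "\<lambda>\<nu>. real_distribution \<nu> \<and>
     (\<forall>z\<in>upper_half_plane. recip_cauchy \<nu> z = of_real t * recip_cauchy \<mu> z + (1 - of_real t) * z)"
  define F where "F z = of_real t * recip_cauchy \<mu> z + (1 - of_real t) * z" for z
  have F_eq: "F z - z = of_real t * (recip_cauchy \<mu> z - z)" for z
    by (simp add: F_def algebra_simps)
  have holF: "F holomorphic_on upper_half_plane"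
    unfolding F_def by (intro holomorphic_intros holomorphic_recip_cauchy)
  have geF: "Im z \<le> Im (F z)" if "Im z > 0" for z
  proof -
    have "Im (F z - z) \<ge> 0"
      unfolding F_eq using recip_cauchy_minus_id(2)[OF \<mu> that] t by simp
    then show ?thesis by simp
  qed
  have limF: "((\<lambda>y. norm (F (\<i> * of_real y) - \<i> * of_real y) / y) \<longlongrightarrow> 0) at_top"
    using tendsto_mult_left[OF recip_cauchy_minus_id(3)[OF \<mu>], of t] t
    by (simp add: F_eq norm_mult)
  obtain \<nu> where "real_distribution \<nu>" "\<And>z. Im z > 0 \<Longrightarrow> recip_cauchy \<nu> z = F z"
    using recip_cauchy_exists[OF holF geF limF] by blast
  then have "?P \<nu>" by (simp add: F_def)
  moreover have "\<nu>' = \<nu>" if "?P \<nu>'" for \<nu>'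
    using that \<open>?P \<nu>\<close> by (intro recip_cauchy_unique) auto
  ultimately have "?P (boolean_power \<mu> t)"
    unfolding boolean_power_def by (rule theI)
  then show "real_distribution (boolean_power \<mu> t)"
    and "Im z > 0 \<Longrightarrow> recip_cauchy (boolean_power \<mu> t) z = of_real t * recip_cauchy \<mu> z + (1 - of_real t) * z"
    by simp_all
qed

theorem proposition3p1:
  fixes p q :: real and \<mu> :: "real measure"
  assumes "p \<ge> 1" and "q > (p - 1) / p" and "real_distribution \<mu>"
  shows "let p' = p * q / (1 - p + p * q); q' = 1 - p + p * q in
           p' \<ge> 1 \<and> q' > 0 \<and>
           boolean_power (free_power \<mu> p) q = free_power (boolean_power \<mu> q') p'"
proof -
  define p' q' where "p' = p * q / (1 - p + p * q)" and "q' = 1 - p + p * q"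
  have "(p - 1) / p \<ge> 0" using assms(1) by simp
  then have q: "q > 0" using assms(2) by linarith
  have q': "q' > 0" using assms(1,2) by (simp add: q'_def field_simps)
  \<comment> \<open>Indeed p' - 1 = (p - 1) / q'.\<close>
  have p': "p' \<ge> 1" using assms(1) q' by (simp add: p'_def q'_def)
  have pq: "p' * q' = p * q" using q' by (simp add: p'_def q'_def)
  define A where "A = free_power \<mu> p"
  define B where "B = boolean_power \<mu> q'"
  note A = free_power_subordination[OF assms(3,1), folded A_def]
  note B = boolean_power[OF assms(3) q', folded B_def]
  note R = boolean_power[OF A(1) q]
  have "free_power B p' = boolean_power A q"
  proof (rule free_power_eqI[OF B(1) R(1) p'])
    fix w assume w: "Im w > 0"
      and u: "Im (of_real p' * w + (1 - of_real p') * recip_cauchy B w) > 0"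
    let ?F = "recip_cauchy \<mu> w"
    have pq_c: "complex_of_real p' * of_real q' = of_real p * of_real q"
      using pq by (metis of_real_mult)
    have q'_c: "complex_of_real q' = 1 - of_real p + of_real p * of_real q"
      by (simp add: q'_def)
    \<comment> \<open>By p' q' = p q the coefficient of F(w) is q' - p q = 1 - p, and that of w is 1
      - q' + p q = p.\<close>
    have eq: "of_real p' * w + (1 - of_real p') * recip_cauchy B w = of_real p * w + (1 - of_real p) * ?F"
    proof -
      have "of_real p' * w + (1 - of_real p') * recip_cauchy B w
          = (of_real q' - of_real p' * of_real q') * ?F + (1 - of_real q' + of_real p' * of_real q') * w"
        unfolding B(2)[OF w] by (simp add: algebra_simps)
      also have "\<dots> = of_real p * w + (1 - of_real p) * ?F"
        by (simp only: pq_c) (simp add: q'_c algebra_simps)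
      finally show ?thesis .
    qed
    have u': "Im (of_real p * w + (1 - of_real p) * ?F) > 0" using u unfolding eq .
    show "recip_cauchy (boolean_power A q) (of_real p' * w + (1 - of_real p') * recip_cauchy B w)
        = recip_cauchy B w"
      \<comment> \<open>What remains is q F + (1 - q) (p w + (1 - p) F) = q' F + (1 - q') w, which
        is where the formula for q' originates.\<close>
      unfolding eq unfolding R(2)[OF u'] A(2)[OF w u'] unfolding B(2)[OF w] q'_c by (simp add: algebra_simps)
  qed
  then show ?thesis
    using p' q' by (simp add: Let_def A_def B_def p'_def q'_def)
qed

end
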